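(* (1) The space $\tilde{\cal U}$ of quasi left anti regular functions $\mathbb H_{\mathbb C}\to\mathbb S$ (possibly with singularities) is invariant under the following action of $GL(2,\mathbb H_{\mathbb C})$: $$(\pi'_l(h)f)(Z)=\frac{a'-Zc'}{N(a'-Zc')}\cdot f\bigl((a'-Zc')^{-1}(-b'+Zd')\bigr),\qquad h=\bigl(\begin{smallmatrix}a'&b'\\c'&d'\end{smallmatrix}\bigr)\in GL(2,\mathbb H_{\mathbb C}).$$ (2) The space $\tilde{\cal U}'$ of quasi right anti regular functions $\mathbb H_{\mathbb C}\to\mathbb S'$ (possibly with singularities) is invariant under the following action of $GL(2,\mathbb H_{\mathbb C})$: $$(\pi'_r(h)g)(Z)=g\bigl((aZ+b)(cZ+d)^{-1}\bigr)\cdot\frac{cZ+d}{N(cZ+d)},\qquad h^{-1}=\bigl(\begin{smallmatrix}a&b\\c&d\end{smallmatrix}\bigr)\in GL(2,\mathbb H_{\mathbb C}).$$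
   Context: $\mathbb H_{\mathbb C}=\mathbb C\otimes_{\mathbb R}\mathbb H$ is identified with $2\times2$ complex matrices $Z=z^0e_0+z^1e_1+z^2e_2+z^3e_3$, $z^j\in\mathbb C$, with $e_0=1$, $e_1=\bigl(\begin{smallmatrix}0&-i\\-i&0\end{smallmatrix}\bigr)$, $e_2=\bigl(\begin{smallmatrix}0&-1\\1&0\end{smallmatrix}\bigr)$, $e_3=\bigl(\begin{smallmatrix}-i&0\\0&i\end{smallmatrix}\bigr)$; $N(Z)=\det Z$. $GL(2,\mathbb H_{\mathbb C})\simeq GL(4,\mathbb C)$. $\mathbb S$ and $\mathbb S'$ are the spaces of complex $2$-columns and $2$-rows, respectively a left and a right $\mathbb H_{\mathbb C}$-module. $\nabla=e_0\frac{\partial}{\partial z^0}-e_1\frac{\partial}{\partial z^1}-e_2\frac{\partial}{\partial z^2}-e_3\frac{\partial}{\partial z^3}$, $\square=\sum_{j=0}^3\frac{\partial^2}{(\partial z^j)^2}$; $g\overleftarrow\nabla$ denotes $\nabla$ acting on $g$ from the right, $g\overleftarrow\nabla=\frac{\partial g}{\partial z^0}e_0-\sum_{j=1}^3\frac{\partial g}{\partial z^j}e_j$. On an open set $U\subset\mathbb H_{\mathbb C}$, a holomorphic $f:U\to\mathbb S$ is quasi left anti regular if $\nabla\square f=0$ on $U$; a holomorphic $g:U\to\mathbb S'$ is quasi right anti regular if $(\square g)\overleftarrow\nabla=0$ on $U$. "Possibly with singularities" means that functions are defined and holomorphic on open subsets of $\mathbb H_{\mathbb C}$; invariance means that if $f$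 (resp. $g$) is quasi left (resp. right) anti regular on an open $U$, then $\pi'_l(h)f$ (resp. $\pi'_r(h)g$) is quasi left (resp. right) anti regular on the open set of $Z$ for which the expression makes sense, i.e. where the matrix to be inverted is invertible and the argument of $f$ (resp. $g$) lies in $U$. *)

theory Defs
  imports "HOL-Analysis.Analysis"
begin

type_synonym hc = "complex^2^2"
type_synonym spinor = "complex^2"

text \<open>
  Both the complex \<open>2\<close>-columns and the complex \<open>2\<close>-rows are rendered by \<^typ>\<open>spinor\<close>; the left
  action on columns is \<open>A *v s\<close>, the right action on rows is \<open>s v* A\<close>.
\<close>

definition hc_scale :: "complex \<Rightarrow> hc \<Rightarrow> hc"  (infixr \<open>*C\<close> 75)
  where "c *C A = (\<chi> i j. c * A $ i $ j)"

text \<open>The basis \<open>e 0, ..., e 3\<close>; the index is only ever used in the range \<open>0..3\<close>.\<close>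

definition hc_e :: "nat \<Rightarrow> hc"
  where "hc_e j =
    (if j = 0 then mat 1
     else if j = 1 then vector [vector [0, -\<i>], vector [-\<i>, 0]]
     else if j = 2 then vector [vector [0, -1], vector [1, 0]]
     else vector [vector [-\<i>, 0], vector [0, \<i>]])"

abbreviation hc_N :: "hc \<Rightarrow> complex"
  where "hc_N Z \<equiv> det Z"

lemma sum_upto_3: "(\<Sum>j\<le>3::nat. f j) = f 0 + f 1 + f 2 + (f 3 :: 'a :: comm_monoid_add)"
  by (simp add: numeral_3_eq_3 numeral_2_eq_2)

lemma hc_coordinates:
  "\<exists>z. (Z::hc) = (\<Sum>j\<le>3. z j *C hc_e j)"
proof
  define z :: "nat \<Rightarrow> complex" where "z = (\<lambda>j.
    if j = 0 then (Z $ 1 $ 1 + Z $ 2 $ 2) / 2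
    else if j = 1 then \<i> * (Z $ 1 $ 2 + Z $ 2 $ 1) / 2
    else if j = 2 then (Z $ 2 $ 1 - Z $ 1 $ 2) / 2
    else \<i> * (Z $ 1 $ 1 - Z $ 2 $ 2) / 2)"
  show "Z = (\<Sum>j\<le>3. z j *C hc_e j)"
    unfolding sum_upto_3
    by (simp add: vec_eq_iff forall_2 hc_scale_def hc_e_def z_def mat_def field_simps)
qed

lemma hc_N_coordinates:
  "hc_N (\<Sum>j\<le>3. z j *C hc_e j) = (\<Sum>j\<le>3. (z j)\<^sup>2)"
  unfolding sum_upto_3
  by (simp add: det_2 hc_scale_def hc_e_def mat_def power2_eq_square algebra_simps)

text \<open>Holomorphy in several variables: complex-linear Frechet derivative at every point.\<close>

definition hc_holomorphic_on :: "(hc \<Rightarrow> spinor) \<Rightarrow> hc set \<Rightarrow> bool"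
  where "hc_holomorphic_on f U \<longleftrightarrow>
    (\<forall>Z\<in>U. \<exists>D. (f has_derivative D) (at Z) \<and> (\<forall>c H. D (c *C H) = c *s D H))"

text \<open>
  The complex partial derivative in the coordinate \<open>z\<^sup>j\<close>, taken componentwise since \<^const>\<open>deriv\<close>
  is for scalar functions only.
\<close>

definition hc_pd :: "nat \<Rightarrow> (hc \<Rightarrow> spinor) \<Rightarrow> hc \<Rightarrow> spinor"
  where "hc_pd j f Z = (\<chi> i. deriv (\<lambda>t. f (Z + t *C hc_e j) $ i) 0)"

definition hc_box :: "(hc \<Rightarrow> spinor) \<Rightarrow> hc \<Rightarrow> spinor"
  where "hc_box f Z = (\<Sum>j\<le>3. hc_pd j (hc_pd j f) Z)"

definition nabla_left :: "(hc \<Rightarrow> spinor) \<Rightarrow> hc \<Rightarrow> spinor"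
  where "nabla_left f Z = hc_e 0 *v hc_pd 0 f Z - (\<Sum>j=1..3. hc_e j *v hc_pd j f Z)"

definition nabla_right :: "(hc \<Rightarrow> spinor) \<Rightarrow> hc \<Rightarrow> spinor"
  where "nabla_right g Z = hc_pd 0 g Z v* hc_e 0 - (\<Sum>j=1..3. hc_pd j g Z v* hc_e j)"

definition quasi_left_anti_regular_on :: "hc set \<Rightarrow> (hc \<Rightarrow> spinor) \<Rightarrow> bool"
  where "quasi_left_anti_regular_on U f \<longleftrightarrow>
    open U \<and> hc_holomorphic_on f U \<and> (\<forall>Z\<in>U. nabla_left (hc_box f) Z = 0)"

definition quasi_right_anti_regular_on :: "hc set \<Rightarrow> (hc \<Rightarrow> spinor) \<Rightarrow> bool"
  where "quasi_right_anti_regular_on U g \<longleftrightarrow>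
    open U \<and> hc_holomorphic_on g U \<and> (\<forall>Z\<in>U. nabla_right (hc_box g) Z = 0)"

text \<open>
  \<open>2 \<times> 2\<close> matrices over the complexified quaternions. The product has to be spelled out: the
  library's \<open>**\<close> at type \<open>hc^2^2\<close> would multiply entries by the componentwise product of \<^typ>\<open>hc\<close>.
\<close>

type_synonym hc_mat = "hc^2^2"

definition hc_mat_mult :: "hc_mat \<Rightarrow> hc_mat \<Rightarrow> hc_mat"
  where "hc_mat_mult h k = (\<chi> i j. \<Sum>l\<in>UNIV. h $ i $ l ** k $ l $ j)"

definition hc_mat_one :: hc_mat
  where "hc_mat_one = (\<chi> i j. if i = j then mat 1 else 0)"

definition GL2_HC :: "hc_mat set"
  where "GL2_HC = {h. \<exists>k. hc_mat_mult h k = hc_mat_one \<and> hc_mat_mult k h = hc_mat_one}"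

definition GL2_HC_inv :: "hc_mat \<Rightarrow> hc_mat"
  where "GL2_HC_inv h = (THE k. hc_mat_mult h k = hc_mat_one \<and> hc_mat_mult k h = hc_mat_one)"

text \<open>
  In the left action \<open>h\<close> itself has the blocks \<open>a', b', c', d'\<close>; in the right action \<open>a, b, c, d\<close>
  are the blocks of the inverse of \<open>h\<close>. The domains consist of those \<open>Z\<close> for which the matrix to
  be inverted is invertible and the argument of the function lies in \<open>U\<close>.
\<close>

definition pi_l :: "hc_mat \<Rightarrow> (hc \<Rightarrow> spinor) \<Rightarrow> hc \<Rightarrow> spinor"
  where "pi_l h f Z =
    (let a' = h $ 1 $ 1; b' = h $ 1 $ 2; c' = h $ 2 $ 1; d' = h $ 2 $ 2; A = a' - Z ** c'
     in ((1 / hc_N A) *C A) *v f (matrix_inv A ** (- b' + Z ** d')))"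

definition pi_l_domain :: "hc_mat \<Rightarrow> hc set \<Rightarrow> hc set"
  where "pi_l_domain h U =
    (let a' = h $ 1 $ 1; b' = h $ 1 $ 2; c' = h $ 2 $ 1; d' = h $ 2 $ 2
     in {Z. invertible (a' - Z ** c') \<and> matrix_inv (a' - Z ** c') ** (- b' + Z ** d') \<in> U})"

definition pi_r :: "hc_mat \<Rightarrow> (hc \<Rightarrow> spinor) \<Rightarrow> hc \<Rightarrow> spinor"
  where "pi_r h g Z =
    (let k = GL2_HC_inv h; a = k $ 1 $ 1; b = k $ 1 $ 2; c = k $ 2 $ 1; d = k $ 2 $ 2;
         A = c ** Z + d
     in g ((a ** Z + b) ** matrix_inv A) v* ((1 / hc_N A) *C A))"

definition pi_r_domain :: "hc_mat \<Rightarrow> hc set \<Rightarrow> hc set"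
  where "pi_r_domain h U =
    (let k = GL2_HC_inv h; a = k $ 1 $ 1; b = k $ 1 $ 2; c = k $ 2 $ 1; d = k $ 2 $ 2
     in {Z. invertible (c ** Z + d) \<and> (a ** Z + b) ** matrix_inv (c ** Z + d) \<in> U})"

end

theory Submission
  imports Defs "HOL-Complex_Analysis.Cauchy_Integral_Formula"
begin

text \<open>
  In the matrix entries \<open>z\<^sub>a\<^sub>b\<close> of \<open>Z\<close> with partial derivatives \<open>D\<^sub>a\<^sub>b\<close> (the constant \<open>dd a b\<close> below),
  \<open>\<nabla>\<close> is twice the matrix of derivatives with rows and columns exchanged, and \<open>\<box>\<close> is four times its
  determinant \<open>D\<^sub>1\<^sub>1 D\<^sub>2\<^sub>2 - D\<^sub>1\<^sub>2 D\<^sub>2\<^sub>1\<close> (\<open>lap\<close>). Quasi left anti regularity thus says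
  \<open>\<Sum>\<^sub>b D\<^sub>b\<^sub>a (lap f\<^sub>b) = 0\<close> for both \<open>a\<close>. In this form two kinds of substitution can be handled directly.

  For an affine map \<open>Z \<mapsto> Q + Z R\<close> the chain rule multiplies \<open>\<nabla>\<box>f\<close> by \<open>det R \<cdot> R\<close> on the left
  (\<open>quasi_left_anti_regular_affine\<close>).

  For the inversion put \<open>v\<^sub>b(W) = f\<^sub>b(W\<^sup>-\<^sup>1) / N(W)\<close>, the Kelvin transforms of the components, so that the
  transformed function is \<open>W v(W)\<close>. Since \<open>\<box>\<close> is the Laplacian in dimension four, \<open>lap v\<^sub>b\<close> is
  \<open>N(W)\<^sup>-\<^sup>3 (lap f\<^sub>b)(W\<^sup>-\<^sup>1)\<close> (\<open>lap_kelvin\<close>). Two terms appear when \<open>\<Sum>\<^sub>c D\<^sub>c\<^sub>a lap\<close> is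
  applied to the rows of \<open>W v\<close>: commuting it past the factor \<open>W\<close> produces \<open>3 lap v\<^sub>a\<close>
  (\<open>dd_lap_matrix_mult\<close>), while the factor \<open>N\<^sup>-\<^sup>3\<close> produces \<open>- 3 lap v\<^sub>a\<close> when it is differentiated.
  They cancel, and what is left is a multiple of \<open>\<nabla>\<box>f\<close> at \<open>W\<^sup>-\<^sup>1\<close>
  (\<open>quasi_left_anti_regular_inversion\<close>).

  Every transformation \<open>\<pi>'\<^sub>l(h)\<close> is, near each point of its domain, a composition of these: three affine
  substitutions interleaved with two inversions, the first being an inversion about a point \<open>S\<close> that is
  close to the given point and generic (\<open>linear_fractional_factorisation\<close>). A single inversion suffices
  when the entry \<open>c'\<close> of \<open>h\<close> is invertible, but not when it is nonzero and singular. The prefactors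
  multiply correctly because \<open>A \<mapsto> A / N(A)\<close> is multiplicative, and the choice of \<open>S\<close> may depend on
  the point because quasi anti regularity is a local condition. Matrix transposition exchanges \<open>\<nabla>\<close>
  acting from the left and from the right, and turns the right action into the left one.

  Underneath lies the fact that the partial derivatives of a function that is holomorphic in the sense of
  having a complex linear derivative are holomorphic again and commute. Both follow by writing a partial
  derivative as a Cauchy integral over a circle and differentiating under the integral sign
  (\<open>dd_has_grad_dd\<close>, \<open>dd_commute\<close>).
\<close>


section \<open>Complex gradients in the matrix entries\<close>

text \<open>
  The gradient \<open>g\<close> is recorded by its entries, so that complex linearity of the derivative is built
  into its shape, and derivatives of explicit expressions are computed by the rules below.
\<close>

definition has_grad :: "(hc \<Rightarrow> complex) \<Rightarrow> (2 \<Rightarrow> 2 \<Rightarrow> complex) \<Rightarrow> hc \<Rightarrow> bool"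
  where "has_grad u g Z \<longleftrightarrow> (u has_derivative (\<lambda>H. \<Sum>a\<in>UNIV. \<Sum>b\<in>UNIV. H $ a $ b * g a b)) (at Z)"

definition unit_mat :: "2 \<Rightarrow> 2 \<Rightarrow> hc"
  where "unit_mat a b = (\<chi> i j. if i = a \<and> j = b then 1 else 0)"

definition dd :: "2 \<Rightarrow> 2 \<Rightarrow> (hc \<Rightarrow> complex) \<Rightarrow> hc \<Rightarrow> complex"
  where "dd a b u Z = deriv (\<lambda>t. u (Z + t *C unit_mat a b)) 0"

text \<open>
  A spinor valued function satisfies \<^const>\<open>hc_holomorphic_on\<close> exactly when both of its components
  satisfy this; see \<open>hc_holomorphic_on_iff\<close> below.
\<close>

definition hol_on :: "(hc \<Rightarrow> complex) \<Rightarrow> hc set \<Rightarrow> bool"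
  where "hol_on u U \<longleftrightarrow> (\<forall>Z\<in>U. \<exists>g. has_grad u g Z)"

lemma hc_scale_nth [simp]: "(c *C A) $ i $ j = c * A $ i $ j"
  by (simp add: hc_scale_def)

lemma unit_mat_nth [simp]: "unit_mat a b $ i $ j = (if i = a \<and> j = b then 1 else 0)"
  by (simp add: unit_mat_def)

lemma has_grad_along_line:
  assumes "has_grad u g (Z + s *C H)"
  shows "((\<lambda>t. u (Z + t *C H)) has_field_derivative (\<Sum>a\<in>UNIV. \<Sum>b\<in>UNIV. H $ a $ b * g a b)) (at s)"
proof -
  have "((\<lambda>t. Z + t *C H) has_derivative (\<lambda>t. t *C H)) (at s)"
  proof -
    have "bounded_linear (\<lambda>t. t *C H)"
      by (rule linear_conv_bounded_linear[THEN iffD1], rule linearI) 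
        (auto simp: vec_eq_iff algebra_simps)
    from bounded_linear.has_derivative[OF this has_derivative_ident]
    show ?thesis by (auto intro!: derivative_eq_intros)
  qed
  from has_derivative_compose[OF this assms[unfolded has_grad_def]]
  show ?thesis
    unfolding has_field_derivative_def
    by (rule has_derivative_eq_rhs) (auto simp: fun_eq_iff sum_distrib_left algebra_simps)
qed

lemma has_grad_imp_dd:
  assumes "has_grad u g Z"
  shows "dd a b u Z = g a b"
proof -
  have "has_grad u g (Z + 0 *C unit_mat a b)"
    using assms by (simp add: hc_scale_def vec_eq_iff plus_vec_def)
  from has_grad_along_line[OF this] have "dd a b u Z = (\<Sum>i\<in>UNIV. \<Sum>j\<in>UNIV. unit_mat a b $ i $ j * g i j)"
    unfolding dd_def by (rule DERIV_imp_deriv)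
  also have "\<dots> = g a b"
    using exhaust_2[of a] exhaust_2[of b] by (auto simp: sum_2)
  finally show ?thesis .
qed

lemma hol_on_iff_has_grad_dd: "hol_on u U \<longleftrightarrow> (\<forall>Z\<in>U. has_grad u (\<lambda>a b. dd a b u Z) Z)"
proof -
  have "has_grad u g Z \<Longrightarrow> has_grad u (\<lambda>a b. dd a b u Z) Z" for g Z
    by (simp add: has_grad_imp_dd)
  then show ?thesis unfolding hol_on_def by blast
qed

lemma hol_on_has_grad: "hol_on u U \<Longrightarrow> Z \<in> U \<Longrightarrow> has_grad u (\<lambda>a b. dd a b u Z) Z"
  by (simp add: hol_on_iff_has_grad_dd)

lemma hol_onI: "(\<And>Z. Z \<in> U \<Longrightarrow> has_grad u (g Z) Z) \<Longrightarrow> hol_on u U"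
  unfolding hol_on_def by blast

lemma has_grad_cong:
  assumes "has_grad u g Z" "open V" "Z \<in> V" "\<And>Y. Y \<in> V \<Longrightarrow> u Y = v Y" "\<And>a b. g a b = h a b"
  shows "has_grad v h Z"
  using has_derivative_transform_within_open[OF assms(1)[unfolded has_grad_def] assms(2,3,4)] assms(5)
  unfolding has_grad_def by simp

lemma hol_on_cong:
  assumes "hol_on u V" "open V" "\<And>Y. Y \<in> V \<Longrightarrow> u Y = v Y"
  shows "hol_on v V"
  unfolding hol_on_def
proof
  fix Z assume "Z \<in> V"
  then obtain g where "has_grad u g Z" using assms(1) unfolding hol_on_def by blast
  then have "has_grad v g Z" by (rule has_grad_cong[OF _ assms(2) \<open>Z \<in> V\<close> assms(3) refl])
  then show "\<exists>g. has_grad v g Z" by blast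
qed

lemma dd_cong:
  assumes "open V" "Z \<in> V" "\<And>Y. Y \<in> V \<Longrightarrow> u Y = v Y"
  shows "dd a b u Z = dd a b v Z"
proof -
  have "((\<lambda>t. Z + t *C unit_mat a b) \<longlongrightarrow> Z + 0 *C unit_mat a b) (at 0)"
    unfolding hc_scale_def by (intro tendsto_intros)
  then have "((\<lambda>t. Z + t *C unit_mat a b) \<longlongrightarrow> Z) (at 0)"
    by (simp add: hc_scale_def vec_eq_iff plus_vec_def)
  then have "\<forall>\<^sub>F t in at 0. Z + t *C unit_mat a b \<in> V"
    using assms(1,2) by (rule topological_tendstoD)
  then have "\<forall>\<^sub>F t in nhds 0. Z + t *C unit_mat a b \<in> V"
    using assms(2) by (simp add: eventually_nhds_conv_at hc_scale_def vec_eq_iff plus_vec_def)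
  then show ?thesis
    unfolding dd_def by (intro deriv_cong_ev refl) (auto elim!: eventually_mono simp: assms(3))
qed

lemma has_grad_eq: "has_grad u g Z \<Longrightarrow> g = h \<Longrightarrow> has_grad u h Z"
  by simp

lemma has_grad_const: "has_grad (\<lambda>Z. c) (\<lambda>a b. 0) Z"
  unfolding has_grad_def by simp

lemma has_grad_entry: "has_grad (\<lambda>Z. Z $ i $ j) (\<lambda>a b. if a = i \<and> b = j then 1 else 0) Z"
  unfolding has_grad_def
proof (rule has_derivative_eq_rhs)
  show "((\<lambda>Z. Z $ i $ j) has_derivative (\<lambda>H::hc. H $ i $ j)) (at Z)"
    by (intro bounded_linear_imp_has_derivative bounded_linear_compose[OF bounded_linear_vec_nth] bounded_linear_vec_nth)
  show "(\<lambda>H::hc. H $ i $ j) = (\<lambda>H. \<Sum>a\<in>UNIV. \<Sum>b\<in>UNIV. H $ a $ b * (if a = i \<and> b = j then 1 else 0))"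
    using exhaust_2[of i] exhaust_2[of j] by (auto simp: sum_2 fun_eq_iff)
qed

lemma has_grad_add:
  "has_grad u g Z \<Longrightarrow> has_grad v h Z \<Longrightarrow> has_grad (\<lambda>Z. u Z + v Z) (\<lambda>a b. g a b + h a b) Z"
  unfolding has_grad_def
  by (rule has_derivative_eq_rhs, erule (1) has_derivative_add) (auto simp: fun_eq_iff sum.distrib algebra_simps)

lemma has_grad_mult:
  "has_grad u g Z \<Longrightarrow> has_grad v h Z \<Longrightarrow>
    has_grad (\<lambda>Z. u Z * v Z) (\<lambda>a b. u Z * h a b + g a b * v Z) Z"
  unfolding has_grad_def
  by (rule has_derivative_eq_rhs, erule (1) has_derivative_mult)
     (auto simp: fun_eq_iff sum_2 algebra_simps)

lemma has_grad_cmult: "has_grad u g Z \<Longrightarrow> has_grad (\<lambda>Z. c * u Z) (\<lambda>a b. c * g a b) Z"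
  using has_grad_mult[OF has_grad_const[of c], of u g Z] by simp

lemma has_grad_minus: "has_grad u g Z \<Longrightarrow> has_grad (\<lambda>Z. - u Z) (\<lambda>a b. - g a b) Z"
  using has_grad_cmult[of u g Z "-1"] by simp

lemma has_grad_diff:
  "has_grad u g Z \<Longrightarrow> has_grad v h Z \<Longrightarrow> has_grad (\<lambda>Z. u Z - v Z) (\<lambda>a b. g a b - h a b) Z"
  using has_grad_add[OF _ has_grad_minus, of u g Z v h] by simp

lemma has_grad_sum_2:
  "(\<And>i::2. has_grad (u i) (g i) Z) \<Longrightarrow> has_grad (\<lambda>Z. \<Sum>i\<in>UNIV. u i Z) (\<lambda>a b. \<Sum>i\<in>UNIV. g i a b) Z"
  unfolding sum_2 by (intro has_grad_add)

lemma has_grad_inverse: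
  assumes "has_grad u g Z" "u Z \<noteq> 0"
  shows "has_grad (\<lambda>Z. inverse (u Z)) (\<lambda>a b. - (inverse (u Z))\<^sup>2 * g a b) Z"
  using Deriv.has_derivative_inverse[OF assms(2) assms(1)[unfolded has_grad_def]]
  unfolding has_grad_def
  by (rule has_derivative_eq_rhs) (auto simp: fun_eq_iff sum_2 algebra_simps power2_eq_square)

lemma has_derivative_vec_components:
  assumes "\<And>i. ((\<lambda>x. f x $ i) has_derivative (\<lambda>h. f' h $ i)) (at x)"
  shows "((f :: 'a::real_normed_vector \<Rightarrow> 'b::euclidean_space ^ 'n) has_derivative f') (at x)"
proof (subst has_derivative_componentwise_within, rule ballI)
  fix b :: "'b ^ 'n" assume "b \<in> Basis"
  then obtain i w where b: "b = axis i w" by (auto simp: Basis_vec_def)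
  show "((\<lambda>x. f x \<bullet> b) has_derivative (\<lambda>x. f' x \<bullet> b)) (at x)"
    unfolding b inner_axis by (intro has_derivative_inner_left assms)
qed

text \<open>
  The chain rule in entries: \<open>k i j a b\<close> is the derivative of the \<open>(i, j)\<close> entry of \<open>\<phi>\<close> in the
  \<open>(a, b)\<close> direction.
\<close>

lemma has_grad_compose:
  assumes "has_grad F g (\<phi> Z)" "\<And>i j. has_grad (\<lambda>Z. \<phi> Z $ i $ j) (k i j) Z"
  shows "has_grad (\<lambda>Z. F (\<phi> Z)) (\<lambda>a b. \<Sum>i\<in>UNIV. \<Sum>j\<in>UNIV. k i j a b * g i j) Z"
proof -
  have D: "(\<phi> has_derivative (\<lambda>H. \<chi> i j. \<Sum>a\<in>UNIV. \<Sum>b\<in>UNIV. H $ a $ b * k i j a b)) (at Z)"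
  proof -
    have "((\<lambda>Z. \<chi> i j. \<phi> Z $ i $ j) has_derivative (\<lambda>H. \<chi> i j. \<Sum>a\<in>UNIV. \<Sum>b\<in>UNIV. H $ a $ b * k i j a b)) (at Z)"
      using assms(2) unfolding has_grad_def
      by (intro has_derivative_vec_components) simp_all
    then show ?thesis by simp
  qed
  from has_derivative_compose[OF D assms(1)[unfolded has_grad_def]]
  show ?thesis
    unfolding has_grad_def
    by (rule has_derivative_eq_rhs) (auto simp: fun_eq_iff sum_2 algebra_simps)
qed

lemma hol_on_continuous_on: "hol_on u U \<Longrightarrow> continuous_on U u"
  unfolding hol_on_def has_grad_def
  by (auto intro!: continuous_at_imp_continuous_on dest: has_derivative_continuous)

lemma hc_holomorphic_on_iff: "hc_holomorphic_on f U \<longleftrightarrow> (\<forall>i. hol_on (\<lambda>Z. f Z $ i) U)"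
proof
  assume L: "hc_holomorphic_on f U"
  show "\<forall>i. hol_on (\<lambda>Z. f Z $ i) U"
    unfolding hol_on_def
  proof (intro allI ballI)
    fix i Z assume "Z \<in> U"
    then obtain D where D: "(f has_derivative D) (at Z)" "\<And>c H. D (c *C H) = c *s D H"
      using L unfolding hc_holomorphic_on_def by blast
    interpret D: linear D using D(1) has_derivative_linear by blast
    have DH: "D H = (\<Sum>a\<in>UNIV. \<Sum>b\<in>UNIV. (H $ a $ b) *s D (unit_mat a b))" for H
    proof -
      have "H = (\<Sum>a\<in>UNIV. \<Sum>b\<in>UNIV. (H $ a $ b) *C unit_mat a b)"
        by (simp add: vec_eq_iff forall_2 sum_2)
      then have "D H = D \<dots>" by (rule arg_cong)
      also have "\<dots> = (\<Sum>a\<in>UNIV. \<Sum>b\<in>UNIV. (H $ a $ b) *s D (unit_mat a b))"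
        by (simp only: sum_2 D.add D(2))
      finally show ?thesis .
    qed
    have "D H $ i = (\<Sum>a\<in>UNIV. \<Sum>b\<in>UNIV. H $ a $ b * (D (unit_mat a b) $ i))" for H
      by (subst DH) (simp add: sum_2)
    moreover have "((\<lambda>Z. f Z $ i) has_derivative (\<lambda>H. D H $ i)) (at Z)"
      using bounded_linear.has_derivative[OF bounded_linear_vec_nth D(1)] .
    ultimately have "has_grad (\<lambda>Z. f Z $ i) (\<lambda>a b. D (unit_mat a b) $ i) Z"
      unfolding has_grad_def by (rule has_derivative_eq_rhs[OF _ ext, rotated])
    then show "\<exists>g. has_grad (\<lambda>Z. f Z $ i) g Z" by blast
  qed
next
  assume R: "\<forall>i. hol_on (\<lambda>Z. f Z $ i) U"
  show "hc_holomorphic_on f U"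
    unfolding hc_holomorphic_on_def
  proof
    fix Z assume "Z \<in> U"
    then have "\<forall>i. \<exists>g. has_grad (\<lambda>Z. f Z $ i) g Z" using R unfolding hol_on_def by blast
    then obtain g where g: "\<And>i. has_grad (\<lambda>Z. f Z $ i) (g i) Z" by metis
    have "((\<lambda>Z. \<chi> i. f Z $ i) has_derivative (\<lambda>H. \<chi> i. \<Sum>a\<in>UNIV. \<Sum>b\<in>UNIV. H $ a $ b * g i a b)) (at Z)"
      using g unfolding has_grad_def by (intro has_derivative_vec_components) auto
    then show "\<exists>D. (f has_derivative D) (at Z) \<and> (\<forall>c H. D (c *C H) = c *s D H)"
      by (intro exI[of _ "\<lambda>H. \<chi> i. \<Sum>a\<in>UNIV. \<Sum>b\<in>UNIV. H $ a $ b * g i a b"])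
         (auto simp: vec_eq_iff sum_2 algebra_simps)
  qed
qed

section \<open>Cauchy integrals for partial derivatives\<close>

lemma unit_mat_scale_in_cball: "norm t \<le> r \<Longrightarrow> Z + t *C unit_mat a b \<in> cball Z r"
proof -
  assume "norm t \<le> r"
  have "norm (t *C unit_mat a b) = norm t"
    using exhaust_2[of a] exhaust_2[of b] 
    by (auto simp: norm_vec_def L2_set_def sum_2)
  then show ?thesis using \<open>norm t \<le> r\<close> by (simp add: dist_norm)
qed

text \<open>
  Cauchy's formula for the derivative, applied to the restriction of \<open>u\<close> to a complex line. After
  parametrising the circle, the factors \<open>2\<pi>\<i>\<close> cancel and one power of the denominator is absorbed.
\<close>

lemma dd_cauchy_integral:
  assumes "hol_on u U" "cball Z r \<subseteq> U" "r > 0"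
  shows "dd a b u Z = integral {0..1::real}
      (\<lambda>x. u (Z + (r * exp (2 * of_real pi * \<i> * x)) *C unit_mat a b) / (r * exp (2 * of_real pi * \<i> * x)))"
proof -
  define h where "h = (\<lambda>t. u (Z + t *C unit_mat a b))"
  have D: "\<exists>d. (h has_field_derivative d) (at t)" if "t \<in> cball 0 r" for t
  proof -
    have "Z + t *C unit_mat a b \<in> U" using that assms(2) unit_mat_scale_in_cball[of t r Z a b] by auto
    from has_grad_along_line[OF hol_on_has_grad[OF assms(1) this]] show ?thesis unfolding h_def by blast
  qed
  have c: "continuous_on (cball 0 r) h"
    by (meson D DERIV_isCont continuous_at_imp_continuous_on)
  have ho: "h holomorphic_on ball 0 r"
    using D by (subst holomorphic_on_open) (auto simp: dist_norm)
  have "(h has_field_derivative (1 / (2 * of_real pi * \<i>) * contour_integral(circlepath 0 r) (\<lambda>u. h u / (u-0)^2))) (at 0)"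
    by (rule Cauchy_derivative_integral_circlepath[OF c ho]) (use assms in auto)
  then have "dd a b u Z = (1 / (2 * of_real pi * \<i>) * contour_integral(circlepath 0 r) (\<lambda>u. h u / u^2))"
    unfolding dd_def h_def[symmetric] by (simp add: DERIV_imp_deriv)
  also have "\<dots> = integral {0..1::real}
      (\<lambda>x. 1 / (2 * of_real pi * \<i>) * (h (r * exp (2 * of_real pi * \<i> * x)) / (r * exp (2 * of_real pi * \<i> * x))^2 * (2 * pi * \<i> * r * exp(2 * of_real pi * \<i> * x))))"
    unfolding contour_integral_integral vector_derivative_circlepath integral_mult_right
    by (simp add: circlepath)
  also have "\<dots> = integral {0..1::real}
      (\<lambda>x. h (r * exp (2 * of_real pi * \<i> * x)) / (r * exp (2 * of_real pi * \<i> * x)))"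
    using assms(3) by (intro integral_cong) (simp add: field_simps power2_eq_square)
  finally show ?thesis unfolding h_def .
qed

text \<open>
  The joint continuity of the integrand in the centre and the parameter of the circle; it serves for
  \<open>u\<close> and for its partial derivatives.
\<close>

lemma circle_param_continuous:
  assumes "continuous_on U v" "\<And>Z. Z \<in> B \<Longrightarrow> cball Z r \<subseteq> U" "r > 0"
  shows "continuous_on (B \<times> cbox 0 (1::real))
     (\<lambda>(Z,x). v (Z + (r * exp (2 * of_real pi * \<i> * x)) *C unit_mat a b) / (r * exp (2 * of_real pi * \<i> * x)))"
proof -
  have "continuous_on (B \<times> cbox 0 (1::real))
     (\<lambda>p. v (fst p + (r * exp (2 * of_real pi * \<i> * snd p)) *C unit_mat a b) / (r * exp (2 * of_real pi * \<i> * snd p)))"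
  proof (intro continuous_intros)
    show "continuous_on (B \<times> cbox 0 1) (\<lambda>p. v (fst p + (complex_of_real r * exp (2 * complex_of_real pi * \<i> * complex_of_real (snd p))) *C unit_mat a b))"
    proof (rule continuous_on_compose2[OF assms(1)])
      show "continuous_on (B \<times> cbox 0 1) (\<lambda>p. fst p + (complex_of_real r * exp (2 * complex_of_real pi * \<i> * complex_of_real (snd p))) *C unit_mat a b)"
        unfolding hc_scale_def by (intro continuous_intros)
      show "(\<lambda>p. fst p + (complex_of_real r * exp (2 * complex_of_real pi * \<i> * complex_of_real (snd p))) *C unit_mat a b) ` (B \<times> cbox 0 1) \<subseteq> U"
        using assms(2,3) unit_mat_scale_in_cball by (fastforce simp: norm_mult)
    qed
  qed (use assms(3) in auto)
  then show ?thesis by (simp add: case_prod_unfold)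
qed

text \<open>
  Existence of a derivative at each point gives continuity of \<open>u\<close> only. By the Cauchy integral this is
  already enough for the partial derivatives to be continuous, which differentiation under the
  integral sign requires.
\<close>

lemma dd_continuous:
  assumes "hol_on u U" "open U"
  shows "continuous_on U (dd a b u)"
proof (rule continuous_at_imp_continuous_on, rule ballI)
  fix Z0 assume "Z0 \<in> U"
  then obtain e where e: "e > 0" "cball Z0 e \<subseteq> U" using assms(2) open_contains_cball by blast
  \<comment> \<open>With half the radius, circles about all points near the centre stay inside the domain.\<close>
  define r where "r = e / 2"
  have r: "r > 0" using e by (simp add: r_def)
  have sub: "cball Z r \<subseteq> U" if "Z \<in> ball Z0 r" for Z
  proof -
    have "cball Z r \<subseteq> cball Z0 e" using that unfolding cball_subset_cball_iff r_def by (simp add: dist_commute)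
    then show ?thesis using e by blast
  qed
  have "continuous_on (ball Z0 r) (\<lambda>Z. integral (cbox 0 (1::real))
      (\<lambda>x. u (Z + (r * exp (2 * of_real pi * \<i> * x)) *C unit_mat a b) / (r * exp (2 * of_real pi * \<i> * x))))"
    by (rule integral_continuous_on_param, rule circle_param_continuous[OF hol_on_continuous_on[OF assms(1)] sub r])
  then have "continuous_on (ball Z0 r) (dd a b u)"
    by (rule continuous_on_eq) (use dd_cauchy_integral[OF assms(1) sub r] in auto)
  then show "isCont (dd a b u) Z0"
    using r by (simp add: continuous_on_eq_continuous_at)
qed

text \<open>
  A partial derivative is differentiable again, with the gradient obtained by differentiating under the
  Cauchy integral. The gradient is kept in integral form since it will be recognised as a Cauchy
  integral of another partial derivative.
\<close>

lemma dd_has_grad_dd: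
  assumes "hol_on u U" "open U" "Z0 \<in> U"
  shows "\<exists>r>0. cball Z0 r \<subseteq> U \<and> has_grad (dd a b u) (\<lambda>c d. integral {0..1::real}
      (\<lambda>x. dd c d u (Z0 + (r * exp (2 * of_real pi * \<i> * x)) *C unit_mat a b) / (r * exp (2 * of_real pi * \<i> * x)))) Z0"
proof -
  obtain e where e: "e > 0" "cball Z0 e \<subseteq> U" using assms(2,3) open_contains_cball by blast
  define r where "r = e / 2"
  have r: "r > 0" using e by (simp add: r_def)
  have sub: "cball Z r \<subseteq> U" if "Z \<in> ball Z0 r" for Z
  proof -
    have "cball Z r \<subseteq> cball Z0 e" using that unfolding cball_subset_cball_iff r_def by (simp add: dist_commute)
    then show ?thesis using e by blast
  qed
  define w where "w = (\<lambda>x::real. r * exp (2 * of_real pi * \<i> * x))"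
  have w: "norm (w x) = r" for x using r by (simp add: w_def norm_mult)
  define k where "k = (\<lambda>c d Z x. dd c d u (Z + w x *C unit_mat a b) / w x)"
  \<comment> \<open>The total derivative of the integrand, as required by the rule for differentiating integrals.\<close>
  define fx where "fx = (\<lambda>Z x. Blinfun (\<lambda>H. \<Sum>c\<in>UNIV. \<Sum>d\<in>UNIV. H $ c $ d * k c d Z x))"
  have bl: "bounded_linear (\<lambda>H::hc. \<Sum>c\<in>UNIV. \<Sum>d\<in>UNIV. H $ c $ d * g c d)" for g :: "2 \<Rightarrow> 2 \<Rightarrow> complex"
    by (intro bounded_linear_sum bounded_linear_compose[OF bounded_linear_mult_left]
         bounded_linear_compose[OF bounded_linear_vec_nth] bounded_linear_vec_nth)
  have fx: "blinfun_apply (fx Z x) H = (\<Sum>c\<in>UNIV. \<Sum>d\<in>UNIV. H $ c $ d * k c d Z x)" for Z x H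
    unfolding fx_def by (simp add: bounded_linear_Blinfun_apply[OF bl])
  have kc: "continuous_on (ball Z0 r \<times> cbox 0 1) (\<lambda>(Z,x). k c d Z x)" for c d
    unfolding k_def w_def
    by (rule circle_param_continuous[OF dd_continuous[OF assms(1,2)] sub r])
  have fxc: "continuous_on (ball Z0 r \<times> cbox 0 1) (\<lambda>(Z,x). fx Z x)"
  proof (rule continuous_on_blinfun_componentwise)
    fix i :: hc
    show "continuous_on (ball Z0 r \<times> cbox 0 1) (\<lambda>p. blinfun_apply (case p of (Z, x) \<Rightarrow> fx Z x) i)"
      using kc unfolding case_prod_unfold fx by (intro continuous_intros)
  qed
  have uc: "continuous_on (ball Z0 r \<times> cbox 0 1) (\<lambda>(Z,x). u (Z + w x *C unit_mat a b) / w x)"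
    unfolding w_def by (rule circle_param_continuous[OF hol_on_continuous_on[OF assms(1)] sub r])
  have der: "((\<lambda>Z. integral (cbox 0 1) (\<lambda>x. u (Z + w x *C unit_mat a b) / w x))
      has_derivative blinfun_apply (integral (cbox 0 1) (fx Z0))) (at Z0 within ball Z0 r)"
  proof (rule leibniz_rule[OF _ _ fxc])
    fix Z x assume Z: "Z \<in> ball Z0 r" and x: "x \<in> cbox 0 (1::real)"
    have "Z + w x *C unit_mat a b \<in> U" using sub[OF Z] unit_mat_scale_in_cball[of "w x" r Z] w by auto
    from hol_on_has_grad[OF assms(1) this]
    have "has_grad (\<lambda>Z. u (Z + w x *C unit_mat a b)) 
       (\<lambda>c d. \<Sum>i\<in>UNIV. \<Sum>j\<in>UNIV. ((if c = i \<and> d = j then 1 else 0) + 0) * dd i j u (Z + w x *C unit_mat a b)) Z"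
      by (rule has_grad_compose) (simp only: vector_add_component has_grad_add has_grad_const has_grad_entry)
    from has_grad_cmult[OF this, of "1 / w x"]
    have "has_grad (\<lambda>Z. u (Z + w x *C unit_mat a b) / w x) (\<lambda>c d. k c d Z x) Z"
    proof (rule has_grad_cong[OF _ open_UNIV])
      fix c d :: 2
      show "1 / w x * (\<Sum>i\<in>UNIV. \<Sum>j\<in>UNIV. ((if c = i \<and> d = j then 1 else 0) + 0) * dd i j u (Z + w x *C unit_mat a b)) = k c d Z x"
        using exhaust_2[of c] exhaust_2[of d] by (auto simp: k_def sum_2)
    qed auto
    then show "((\<lambda>Z. u (Z + w x *C unit_mat a b) / w x) has_derivative blinfun_apply (fx Z x)) (at Z within ball Z0 r)"
      unfolding has_grad_def fx[abs_def] by (rule has_derivative_at_withinI)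
  next
    fix Z assume "Z \<in> ball Z0 r"
    then have "continuous_on (cbox 0 1) (\<lambda>x. case (Z,x) of (Z,x) \<Rightarrow> u (Z + w x *C unit_mat a b) / w x)"
      by (intro continuous_on_compose2[OF uc] continuous_intros) auto
    then show "(\<lambda>x. u (Z + w x *C unit_mat a b) / w x) integrable_on cbox 0 1"
      by (intro integrable_continuous) simp
  qed (use r in auto)
  have fxi: "continuous_on (cbox 0 1) (\<lambda>x. case (Z0,x) of (Z,x) \<Rightarrow> fx Z x)"
    by (intro continuous_on_compose2[OF fxc] continuous_intros) (use r in auto)
  then have "fx Z0 integrable_on cbox 0 1"
    by (intro integrable_continuous) simp
  then have "blinfun_apply (integral (cbox 0 1) (fx Z0)) H = integral (cbox 0 1) (\<lambda>x. blinfun_apply (fx Z0 x) H)" for H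
    by (rule blinfun_apply_integral)
  moreover have kI: "(k c d Z0) integrable_on cbox 0 1" for c d
  proof -
    have "continuous_on (cbox 0 1) (\<lambda>x. case (Z0,x) of (Z,x) \<Rightarrow> k c d Z x)"
      by (intro continuous_on_compose2[OF kc] continuous_intros) (use r in auto)
    then show ?thesis by (intro integrable_continuous) simp
  qed
  have "integral (cbox 0 1) (\<lambda>x. blinfun_apply (fx Z0 x) H) =
     (\<Sum>c\<in>UNIV. \<Sum>d\<in>UNIV. H $ c $ d * integral (cbox 0 1) (k c d Z0))" for H
    unfolding fx sum_2
    using kI by (simp add: integral_add integrable_on_mult_right integrable_add)
  ultimately have ap: "blinfun_apply (integral (cbox 0 1) (fx Z0)) = 
     (\<lambda>H. \<Sum>c\<in>UNIV. \<Sum>d\<in>UNIV. H $ c $ d * integral (cbox 0 1) (k c d Z0))" by (simp add: fun_eq_iff)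
  have "((\<lambda>Z. integral (cbox 0 1) (\<lambda>x. u (Z + w x *C unit_mat a b) / w x))
      has_derivative blinfun_apply (integral (cbox 0 1) (fx Z0))) (at Z0)"
    using der r by (simp add: at_within_open[of Z0 "ball Z0 r"])
  then have "has_grad (\<lambda>Z. integral (cbox 0 1) (\<lambda>x. u (Z + w x *C unit_mat a b) / w x))
      (\<lambda>c d. integral (cbox 0 1) (k c d Z0)) Z0"
    unfolding has_grad_def ap .
  then have "has_grad (dd a b u) (\<lambda>c d. integral (cbox 0 1) (k c d Z0)) Z0"
    by (rule has_grad_cong[of _ _ _ "ball Z0 r"])
       (use r dd_cauchy_integral[OF assms(1) sub r] in \<open>auto simp: w_def\<close>)
  then show ?thesis
    using r sub[of Z0] unfolding k_def w_def by auto
qed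

lemma hol_on_dd: "hol_on u U \<Longrightarrow> open U \<Longrightarrow> hol_on (dd a b u) U"
  unfolding hol_on_def[of "dd a b u"] using dd_has_grad_dd by blast

text \<open>
  The \<open>(a, b)\<close> entry of the gradient of \<open>dd c d u\<close> is a Cauchy integral of \<open>dd a b u\<close>, and Cauchy's
  formula evaluates this integral to \<open>dd c d (dd a b u)\<close>.
\<close>

lemma dd_commute:
  assumes "hol_on u U" "open U" "Z \<in> U"
  shows "dd a b (dd c d u) Z = dd c d (dd a b u) Z"
proof -
  obtain r where r: "r > 0" "cball Z r \<subseteq> U" 
    and g: "has_grad (dd c d u) (\<lambda>a b. integral {0..1::real}
      (\<lambda>x. dd a b u (Z + (r * exp (2 * of_real pi * \<i> * x)) *C unit_mat c d) / (r * exp (2 * of_real pi * \<i> * x)))) Z"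
    using dd_has_grad_dd[OF assms, of c d] by blast
  have "dd a b (dd c d u) Z = integral {0..1::real}
      (\<lambda>x. dd a b u (Z + (r * exp (2 * of_real pi * \<i> * x)) *C unit_mat c d) / (r * exp (2 * of_real pi * \<i> * x)))"
    by (rule has_grad_imp_dd[OF g])
  also have "\<dots> = dd c d (dd a b u) Z"
    by (rule dd_cauchy_integral[OF hol_on_dd[OF assms(1,2)] r(2,1), symmetric])
  finally show ?thesis .
qed

section \<open>The differential operators in matrix entries\<close>

text \<open>
  The determinant of the matrix of entry derivatives, a quarter of \<open>\<box>\<close>; see \<open>hc_box_component\<close>.
\<close>

definition lap :: "(hc \<Rightarrow> complex) \<Rightarrow> hc \<Rightarrow> complex"
  where "lap u Z = dd 1 1 (dd 2 2 u) Z - dd 1 2 (dd 2 1 u) Z"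

lemma hol_on_lap: "hol_on u U \<Longrightarrow> open U \<Longrightarrow> hol_on (lap u) U"
  unfolding lap_def[abs_def]
  by (rule hol_onI, rule has_grad_diff) (rule hol_on_has_grad, simp_all add: hol_on_dd)+

lemma lap_cong:
  assumes "open V" "Z \<in> V" "\<And>Y. Y \<in> V \<Longrightarrow> u Y = v Y"
  shows "lap u Z = lap v Z"
  unfolding lap_def using assms by (intro arg_cong2[where f = "(-)"] dd_cong[of V]) auto

lemma hc_pd_component:
  assumes "hol_on (\<lambda>Z. f Z $ i) U" "Z \<in> U"
  shows "hc_pd j f Z $ i = (\<Sum>a\<in>UNIV. \<Sum>b\<in>UNIV. hc_e j $ a $ b * dd a b (\<lambda>Z. f Z $ i) Z)"
proof -
  have "has_grad (\<lambda>Z. f Z $ i) (\<lambda>a b. dd a b (\<lambda>Z. f Z $ i) Z) (Z + 0 *C hc_e j)"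
    using hol_on_has_grad[OF assms] by (simp add: hc_scale_def vec_eq_iff plus_vec_def)
  from has_grad_along_line[OF this] show ?thesis
    unfolding hc_pd_def by (simp add: DERIV_imp_deriv)
qed

lemma hc_pd_component_has_grad:
  assumes "hol_on (\<lambda>Z. f Z $ i) U" "open U" "Z \<in> U"
  shows "has_grad (\<lambda>Z. hc_pd j f Z $ i)
    (\<lambda>c d. \<Sum>a\<in>UNIV. \<Sum>b\<in>UNIV. hc_e j $ a $ b * dd c d (dd a b (\<lambda>Z. f Z $ i)) Z) Z"
proof (rule has_grad_cong[OF _ assms(2,3) _ refl])
  show "has_grad (\<lambda>Z. \<Sum>a\<in>UNIV. \<Sum>b\<in>UNIV. hc_e j $ a $ b * dd a b (\<lambda>Z. f Z $ i) Z)
    (\<lambda>c d. \<Sum>a\<in>UNIV. \<Sum>b\<in>UNIV. hc_e j $ a $ b * dd c d (dd a b (\<lambda>Z. f Z $ i)) Z) Z"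
    by (intro has_grad_sum_2 has_grad_cmult hol_on_has_grad[of _ U] hol_on_dd assms)
qed (simp add: hc_pd_component[OF assms(1)])

text \<open>
  The counterpart for derivatives of \<open>N\<close> being both a determinant and a sum of four squares: when
  the coordinate derivatives are expanded in entry derivatives, the pure squares cancel in pairs and the
  mixed terms combine by symmetry.
\<close>

lemma hc_box_component:
  assumes "hol_on (\<lambda>Z. f Z $ i) U" "open U" "Z \<in> U"
  shows "hc_box f Z $ i = 4 * lap (\<lambda>Z. f Z $ i) Z"
proof -
  have pd2: "hc_pd k (hc_pd j f) Z $ i = (\<Sum>c\<in>UNIV. \<Sum>d\<in>UNIV. hc_e k $ c $ d *
      (\<Sum>a\<in>UNIV. \<Sum>b\<in>UNIV. hc_e j $ a $ b * dd c d (dd a b (\<lambda>Z. f Z $ i)) Z))" for j k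
  proof -
    have h: "hol_on (\<lambda>Z. hc_pd j f Z $ i) U"
      by (rule hol_onI, rule hc_pd_component_has_grad[OF assms(1,2)])
    show ?thesis
      unfolding hc_pd_component[OF h assms(3)] has_grad_imp_dd[OF hc_pd_component_has_grad[OF assms]] ..
  qed
  have c: "dd 2 2 (dd 1 1 (\<lambda>Z. f Z $ i)) Z = dd 1 1 (dd 2 2 (\<lambda>Z. f Z $ i)) Z"
      "dd 2 1 (dd 1 2 (\<lambda>Z. f Z $ i)) Z = dd 1 2 (dd 2 1 (\<lambda>Z. f Z $ i)) Z"
    by (rule dd_commute[OF assms])+
  show ?thesis
    unfolding hc_box_def sum_upto_3
    by (simp add: pd2 sum_2 hc_e_def mat_def lap_def c algebra_simps)
qed

lemma sum_1_to_3: "(\<Sum>j=1..3. X j) = X 1 + X 2 + (X (3::nat) :: 'a :: comm_monoid_add)"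
  by (simp add: numeral_3_eq_3 numeral_2_eq_2)

lemma nabla_left_component:
  assumes "\<And>i. hol_on (\<lambda>Z. f Z $ i) U" "Z \<in> U"
  shows "nabla_left f Z $ a = 2 * (\<Sum>b\<in>UNIV. dd b a (\<lambda>Z. f Z $ b) Z)"
  using exhaust_2[of a] unfolding nabla_left_def sum_1_to_3
  by (auto simp: matrix_vector_mult_def hc_pd_component[OF assms] sum_2 hc_e_def mat_def algebra_simps)

lemma nabla_right_component:
  assumes "\<And>i. hol_on (\<lambda>Z. f Z $ i) U" "Z \<in> U"
  shows "nabla_right f Z $ a = 2 * (\<Sum>b\<in>UNIV. dd a b (\<lambda>Z. f Z $ b) Z)"
  using exhaust_2[of a] unfolding nabla_right_def sum_1_to_3
  by (auto simp: vector_matrix_mult_def hc_pd_component[OF assms] sum_2 hc_e_def mat_def algebra_simps)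

lemma dd_cmult:
  assumes "hol_on u U" "Z \<in> U"
  shows "dd a b (\<lambda>Z. c * u Z) Z = c * dd a b u Z"
  using has_grad_imp_dd[OF has_grad_cmult[OF hol_on_has_grad[OF assms]]] .

lemma hc_box_component_hol_on:
  assumes "hol_on (\<lambda>Z. f Z $ i) U" "open U"
  shows "hol_on (\<lambda>Z. hc_box f Z $ i) U"
proof (rule hol_on_cong[OF _ assms(2)])
  show "hol_on (\<lambda>Z. 4 * lap (\<lambda>Z. f Z $ i) Z) U"
    by (rule hol_onI, rule has_grad_cmult, rule hol_on_has_grad[OF hol_on_lap[OF assms]])
qed (simp add: hc_box_component[OF assms])

lemma dd_hc_box_component:
  assumes "hol_on (\<lambda>Z. f Z $ i) U" "open U" "Z \<in> U"
  shows "dd a b (\<lambda>Z. hc_box f Z $ i) Z = 4 * dd a b (lap (\<lambda>Z. f Z $ i)) Z"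
proof -
  have "dd a b (\<lambda>Z. hc_box f Z $ i) Z = dd a b (\<lambda>Z. 4 * lap (\<lambda>Z. f Z $ i) Z) Z"
    by (rule dd_cong[OF assms(2,3)]) (rule hc_box_component[OF assms(1,2)])
  then show ?thesis by (simp add: dd_cmult[OF hol_on_lap[OF assms(1,2)] assms(3)])
qed

lemma quasi_left_anti_regular_on_iff:
  "quasi_left_anti_regular_on U f \<longleftrightarrow> open U \<and> (\<forall>i. hol_on (\<lambda>Z. f Z $ i) U) \<and>
    (\<forall>Z\<in>U. \<forall>a. (\<Sum>b\<in>UNIV. dd b a (lap (\<lambda>Z. f Z $ b)) Z) = 0)"
proof -
  have "nabla_left (hc_box f) Z $ a = 8 * (\<Sum>b\<in>UNIV. dd b a (lap (\<lambda>Z. f Z $ b)) Z)"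
    if "open U" "\<And>i. hol_on (\<lambda>Z. f Z $ i) U" "Z \<in> U" for Z a
    unfolding nabla_left_component[OF hc_box_component_hol_on[OF that(2,1)] that(3)]
    by (simp add: dd_hc_box_component[OF that(2,1,3)] sum_2)
  then show ?thesis
    unfolding quasi_left_anti_regular_on_def hc_holomorphic_on_iff by (auto simp: vec_eq_iff)
qed

lemma quasi_right_anti_regular_on_iff:
  "quasi_right_anti_regular_on U f \<longleftrightarrow> open U \<and> (\<forall>i. hol_on (\<lambda>Z. f Z $ i) U) \<and>
    (\<forall>Z\<in>U. \<forall>a. (\<Sum>b\<in>UNIV. dd a b (lap (\<lambda>Z. f Z $ b)) Z) = 0)"
proof -
  have "nabla_right (hc_box f) Z $ a = 8 * (\<Sum>b\<in>UNIV. dd a b (lap (\<lambda>Z. f Z $ b)) Z)"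
    if "open U" "\<And>i. hol_on (\<lambda>Z. f Z $ i) U" "Z \<in> U" for Z a
    unfolding nabla_right_component[OF hc_box_component_hol_on[OF that(2,1)] that(3)]
    by (simp add: dd_hc_box_component[OF that(2,1,3)] sum_2)
  then show ?thesis
    unfolding quasi_right_anti_regular_on_def hc_holomorphic_on_iff by (auto simp: vec_eq_iff)
qed

text \<open>
  This is what allows the factorisation of a fractional linear map to depend on the point.
\<close>

lemma quasi_left_anti_regular_on_localI:
  assumes local: "\<And>Z. Z \<in> V \<Longrightarrow>
    \<exists>W G. Z \<in> W \<and> W \<subseteq> V \<and> quasi_left_anti_regular_on W G \<and> (\<forall>Y\<in>W. F Y = G Y)"
  shows "quasi_left_anti_regular_on V F"
proof -
  have *: "(\<exists>W. open W \<and> Z \<in> W \<and> W \<subseteq> V) \<and> (\<forall>i. \<exists>g. has_grad (\<lambda>Z. F Z $ i) g Z) \<and>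
      (\<forall>a. (\<Sum>b\<in>UNIV. dd b a (lap (\<lambda>Z. F Z $ b)) Z) = 0)" if ZV: "Z \<in> V" for Z
  proof -
    obtain W G where W: "Z \<in> W" "W \<subseteq> V" and G: "quasi_left_anti_regular_on W G"
      and eq: "\<And>Y. Y \<in> W \<Longrightarrow> G Y = F Y"
      using local[OF ZV] by metis
    have oW: "open W" and hG: "\<And>i. hol_on (\<lambda>Z. G Z $ i) W"
      and rG: "\<And>a. (\<Sum>b\<in>UNIV. dd b a (lap (\<lambda>Z. G Z $ b)) Z) = 0"
      using G W(1) unfolding quasi_left_anti_regular_on_iff by blast+
    have eq': "G Y $ i = F Y $ i" if "Y \<in> W" for Y i by (simp only: eq[OF that])
    have "\<exists>g. has_grad (\<lambda>Z. F Z $ i) g Z" for i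
      using hol_on_cong[OF hG oW eq'] W(1) unfolding hol_on_def by blast
    moreover have "dd b a (lap (\<lambda>Z. G Z $ b)) Z = dd b a (lap (\<lambda>Z. F Z $ b)) Z" for a b
      by (rule dd_cong[OF oW W(1)], rule lap_cong[OF oW _ eq'])
    ultimately show ?thesis
      using oW W rG by auto
  qed
  have "open V"
    by (subst open_subopen, rule ballI) (use * in blast)
  then show ?thesis
    unfolding quasi_left_anti_regular_on_iff hol_on_def using * by blast
qed

section \<open>Affine substitutions\<close>

lemma has_grad_compose_affine:
  assumes "has_grad u g (Q + Z ** R)"
  shows "has_grad (\<lambda>Z. u (Q + Z ** R)) (\<lambda>a b. \<Sum>j\<in>UNIV. R $ b $ j * g a j) Z"
proof -
  have "has_grad (\<lambda>Z. u (Q + Z ** R))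
     (\<lambda>a b. \<Sum>i\<in>UNIV. \<Sum>j\<in>UNIV. (0 + (\<Sum>l\<in>UNIV. (Z $ i $ l * 0 + (if a = i \<and> b = l then 1 else 0) * R $ l $ j))) * g i j) Z"
  proof (rule has_grad_compose[where \<phi> = "\<lambda>Z. Q + Z ** R", OF assms])
    fix i j
    show "has_grad (\<lambda>Z. (Q + Z ** R) $ i $ j)
        (\<lambda>a b. 0 + (\<Sum>l\<in>UNIV. Z $ i $ l * 0 + (if a = i \<and> b = l then 1 else 0) * R $ l $ j)) Z"
      unfolding vector_add_component matrix_matrix_mult_def vec_lambda_beta
      by (intro has_grad_add has_grad_sum_2 has_grad_mult has_grad_entry has_grad_const)
  qed
  then show ?thesis
  proof (rule has_grad_eq, intro ext)
    fix a b
    show "(\<Sum>i\<in>UNIV. \<Sum>j\<in>UNIV. (0 + (\<Sum>l\<in>UNIV. (Z $ i $ l * 0 + (if a = i \<and> b = l then 1 else 0) * R $ l $ j))) * g i j)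
       = (\<Sum>j\<in>UNIV. R $ b $ j * g a j)"
      using exhaust_2[of a] exhaust_2[of b] by (auto simp: sum_2)
  qed
qed

lemma dd_compose_affine:
  assumes "hol_on u U" "Q + Z ** R \<in> U"
  shows "dd a b (\<lambda>Z. u (Q + Z ** R)) Z = (\<Sum>j\<in>UNIV. R $ b $ j * dd a j u (Q + Z ** R))"
  by (rule has_grad_imp_dd[OF has_grad_compose_affine[OF hol_on_has_grad[OF assms]]])

lemma open_affine_vimage: "open U \<Longrightarrow> open {Z::hc. Q + Z ** R \<in> U}"
  unfolding matrix_matrix_mult_def
  by (rule open_vimage[unfolded vimage_def], assumption) (intro continuous_intros)

text \<open>
  In the affine case the matrix of entry derivatives is multiplied by the transpose of \<open>R\<close>, hence its
  determinant \<open>lap\<close> by \<open>det R\<close>.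
\<close>

lemma dd_lap_compose_affine:
  assumes "hol_on u U" "open U" "Q + Z ** R \<in> U"
  shows "dd a b (lap (\<lambda>Z. u (Q + Z ** R))) Z = det R * (\<Sum>j\<in>UNIV. R $ b $ j * dd a j (lap u) (Q + Z ** R))"
proof -
  define V where "V = {Z. Q + Z ** R \<in> U}"
  have V: "open V" using open_affine_vimage[OF assms(2)] by (simp add: V_def)
  have dd2: "dd a b (dd c d (\<lambda>Z. u (Q + Z ** R))) Y =
     (\<Sum>j\<in>UNIV. R $ d $ j * (\<Sum>l\<in>UNIV. R $ b $ l * dd a l (dd c j u) (Q + Y ** R)))"
    if "Y \<in> V" for a b c d Y
  proof -
    have "dd a b (dd c d (\<lambda>Z. u (Q + Z ** R))) Y = dd a b (\<lambda>Z. \<Sum>j\<in>UNIV. R $ d $ j * dd c j u (Q + Z ** R)) Y"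
      by (rule dd_cong[OF V that]) (simp add: V_def dd_compose_affine[OF assms(1)])
    also have "has_grad (\<lambda>Z. \<Sum>j\<in>UNIV. R $ d $ j * dd c j u (Q + Z ** R))
        (\<lambda>a b. \<Sum>j\<in>UNIV. R $ d $ j * (\<Sum>l\<in>UNIV. R $ b $ l * dd a l (dd c j u) (Q + Y ** R))) Y"
      using that by (intro has_grad_sum_2 has_grad_cmult has_grad_compose_affine
          hol_on_has_grad[OF hol_on_dd[OF assms(1,2)]]) (simp add: V_def)
    note has_grad_imp_dd[OF this]
    finally show ?thesis .
  qed
  have lap: "lap (\<lambda>Z. u (Q + Z ** R)) Y = det R * lap u (Q + Y ** R)" if "Y \<in> V" for Y
  proof -
    have UY: "Q + Y ** R \<in> U" using that by (simp add: V_def)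
    have c: "dd 1 2 (dd 2 2 u) (Q + Y ** R) = dd 2 2 (dd 1 2 u) (Q + Y ** R)"
       "dd 1 1 (dd 2 1 u) (Q + Y ** R) = dd 2 1 (dd 1 1 u) (Q + Y ** R)"
       "dd 1 2 (dd 2 1 u) (Q + Y ** R) = dd 2 1 (dd 1 2 u) (Q + Y ** R)"
       "dd 1 1 (dd 2 2 u) (Q + Y ** R) = dd 2 2 (dd 1 1 u) (Q + Y ** R)"
      by (rule dd_commute[OF assms(1,2) UY])+
    show ?thesis
      unfolding lap_def dd2[OF that] det_2 sum_2 c by (simp add: algebra_simps)
  qed
  have "Z \<in> V" using assms(3) by (simp add: V_def)
  then have "dd a b (lap (\<lambda>Z. u (Q + Z ** R))) Z = dd a b (\<lambda>Y. det R * lap u (Q + Y ** R)) Z"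
    by (intro dd_cong[OF V] lap)
  also have "\<dots> = det R * (\<Sum>j\<in>UNIV. R $ b $ j * dd a j (lap u) (Q + Z ** R))"
    by (rule has_grad_imp_dd[OF has_grad_cmult[OF has_grad_compose_affine[OF
        hol_on_has_grad[OF hol_on_lap[OF assms(1,2)] assms(3)]]]])
  finally show ?thesis .
qed

lemma quasi_left_anti_regular_affine:
  assumes "quasi_left_anti_regular_on U f"
  shows "quasi_left_anti_regular_on {Z. Q + Z ** R \<in> U} (\<lambda>Z. f (Q + Z ** R))"
proof -
  have U: "open U" and h: "\<And>i. hol_on (\<lambda>Z. f Z $ i) U"
    and r: "\<And>Z a. Z \<in> U \<Longrightarrow> (\<Sum>b\<in>UNIV. dd b a (lap (\<lambda>Z. f Z $ b)) Z) = 0"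
    using assms unfolding quasi_left_anti_regular_on_iff by auto
  show ?thesis
    unfolding quasi_left_anti_regular_on_iff
  proof (intro conjI allI ballI)
    show "open {Z. Q + Z ** R \<in> U}" by (rule open_affine_vimage[OF U])
    show "hol_on (\<lambda>Z. f (Q + Z ** R) $ i) {Z. Q + Z ** R \<in> U}" for i
      by (rule hol_onI, rule has_grad_compose_affine, rule hol_on_has_grad[OF h]) simp
    fix Z a assume "Z \<in> {Z. Q + Z ** R \<in> U}"
    then have Z: "Q + Z ** R \<in> U" by simp
    have "(\<Sum>b\<in>UNIV. dd b a (lap (\<lambda>Z. f (Q + Z ** R) $ b)) Z) =
       det R * (\<Sum>j\<in>UNIV. R $ a $ j * (\<Sum>b\<in>UNIV. dd b j (lap (\<lambda>Z. f Z $ b)) (Q + Z ** R)))"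
      unfolding dd_lap_compose_affine[OF h U Z] sum_2 by (simp add: algebra_simps)
    then show "(\<Sum>b\<in>UNIV. dd b a (lap (\<lambda>Z. f (Q + Z ** R) $ b)) Z) = 0"
      by (simp add: r[OF Z])
  qed
qed

section \<open>Inversion and the Kelvin transform\<close>

lemma matrix_inv_mult:
  assumes "det (W::hc) \<noteq> 0"
  shows "W ** matrix_inv W = mat 1" "matrix_inv W ** W = mat 1"
proof -
  have "\<exists>A. W ** A = mat 1 \<and> A ** W = mat 1"
    using assms unfolding invertible_det_nz[symmetric] invertible_def .
  then have "W ** matrix_inv W = mat 1 \<and> matrix_inv W ** W = mat 1"
    unfolding matrix_inv_def by (rule someI_ex)
  then show "W ** matrix_inv W = mat 1" "matrix_inv W ** W = mat 1" by auto
qed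

lemma matrix_inv_entries:
  assumes "det (W::hc) \<noteq> 0"
  shows "matrix_inv W $ 1 $ 1 = W $ 2 $ 2 * inverse (det W)"
        "matrix_inv W $ 1 $ 2 = - W $ 1 $ 2 * inverse (det W)"
        "matrix_inv W $ 2 $ 1 = - W $ 2 $ 1 * inverse (det W)"
        "matrix_inv W $ 2 $ 2 = W $ 1 $ 1 * inverse (det W)"
proof -
  define A :: hc where "A = vector [vector [W $ 2 $ 2 * inverse (det W), - W $ 1 $ 2 * inverse (det W)],
     vector [- W $ 2 $ 1 * inverse (det W), W $ 1 $ 1 * inverse (det W)]]"
  have AW: "A ** W = mat 1"
  proof -
    define n where "n = inverse (det W)"
    have "n * (W $ 1 $ 1 * W $ 2 $ 2 - W $ 1 $ 2 * W $ 2 $ 1) = 1"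
      using assms by (simp add: n_def flip: det_2)
    then show ?thesis
      unfolding A_def n_def[symmetric]
      by (simp add: vec_eq_iff forall_2 matrix_matrix_mult_def sum_2 mat_def algebra_simps)
  qed
  have "matrix_inv W = A ** W ** matrix_inv W" by (simp add: AW)
  also have "\<dots> = A"
    by (simp add: matrix_inv_mult(1)[OF assms] flip: matrix_mul_assoc)
  finally have "matrix_inv W = A" .
  then show "matrix_inv W $ 1 $ 1 = W $ 2 $ 2 * inverse (det W)"
        "matrix_inv W $ 1 $ 2 = - W $ 1 $ 2 * inverse (det W)"
        "matrix_inv W $ 2 $ 1 = - W $ 2 $ 1 * inverse (det W)"
        "matrix_inv W $ 2 $ 2 = W $ 1 $ 1 * inverse (det W)"
    by (simp_all add: A_def)
qed

lemma open_det_nonzero: "open {W::hc. det W \<noteq> 0}"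
  unfolding det_2 by (rule open_Collect_neq) (intro continuous_intros)+

lemma has_grad_det: "has_grad (\<lambda>W. det W)
   (\<lambda>a b. if a = b then (if a = 1 then W $ 2 $ 2 else W $ 1 $ 1) else - W $ b $ a) W"
  unfolding det_2
proof (rule has_grad_eq)
  show "has_grad (\<lambda>W. W $ 1 $ 1 * W $ 2 $ 2 - W $ 1 $ 2 * W $ 2 $ 1) (\<lambda>a b.
     (W $ 1 $ 1 * (if a = 2 \<and> b = 2 then 1 else 0) + (if a = 1 \<and> b = 1 then 1 else 0) * W $ 2 $ 2) -
     (W $ 1 $ 2 * (if a = 2 \<and> b = 1 then 1 else 0) + (if a = 1 \<and> b = 2 then 1 else 0) * W $ 2 $ 1)) W"
    by (intro has_grad_diff has_grad_mult has_grad_entry)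
  show "(\<lambda>a b.
     (W $ 1 $ 1 * (if a = 2 \<and> b = 2 then 1 else 0) + (if a = 1 \<and> b = 1 then 1 else 0) * W $ 2 $ 2) -
     (W $ 1 $ 2 * (if a = 2 \<and> b = 1 then 1 else 0) + (if a = 1 \<and> b = 2 then 1 else 0) * W $ 2 $ 1)) =
     (\<lambda>a b. if a = b then (if a = 1 then W $ 2 $ 2 else W $ 1 $ 1) else - W $ b $ a)"
    unfolding fun_eq_iff forall_2 by simp
qed

lemma has_grad_inverse_det:
  assumes "det W \<noteq> 0"
  shows "has_grad (\<lambda>W. inverse (det W)) (\<lambda>a b. - inverse (det W) * matrix_inv W $ b $ a) W"
  using has_grad_inverse[OF has_grad_det assms]
  by (rule has_grad_eq) (simp add: fun_eq_iff forall_2 matrix_inv_entries[OF assms] power2_eq_square)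

text \<open>
  The entrywise form of \<open>d(W\<^sup>-\<^sup>1) = - W\<^sup>-\<^sup>1 dW W\<^sup>-\<^sup>1\<close>, read off from the cofactor formula.
\<close>

lemma has_grad_matrix_inv:
  assumes "det W \<noteq> 0"
  shows "has_grad (\<lambda>W. matrix_inv W $ i $ j) (\<lambda>a b. - matrix_inv W $ i $ a * matrix_inv W $ b $ j) W"
proof -
  \<comment> \<open>Each entry of the inverse is a signed entry of the matrix divided by the determinant.\<close>
  have *: "has_grad (\<lambda>W. matrix_inv W $ i $ j) (\<lambda>a b. - matrix_inv W $ i $ a * matrix_inv W $ b $ j) W"
    if eq: "\<And>W. det W \<noteq> 0 \<Longrightarrow> matrix_inv W $ i $ j = c * W $ k $ l * inverse (det W)"
    and g: "\<And>a b. c * W $ k $ l * (- inverse (det W) * matrix_inv W $ b $ a) 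
       + c * (if a = k \<and> b = l then 1 else 0) * inverse (det W)
       = - matrix_inv W $ i $ a * matrix_inv W $ b $ j" for i j k l :: 2 and c
    by (rule has_grad_cong[OF has_grad_mult[OF has_grad_cmult[OF has_grad_entry] has_grad_inverse_det[OF assms]]
        open_det_nonzero _ _ g]) (use assms eq in auto)
  define n where "n = inverse (det W)"
  have D: "n * (W $ 1 $ 1 * W $ 2 $ 2 - W $ 1 $ 2 * W $ 2 $ 1) = 1"
    using assms by (simp add: n_def flip: det_2)
  have D2: "n = n * (n * (W $ 1 $ 1 * W $ 2 $ 2 - W $ 1 $ 2 * W $ 2 $ 1))"
    by (simp add: D)
  note e = matrix_inv_entries[OF assms, folded n_def] n_def[symmetric]
  have "\<forall>i j. has_grad (\<lambda>W. matrix_inv W $ i $ j) (\<lambda>a b. - matrix_inv W $ i $ a * matrix_inv W $ b $ j) W"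
    unfolding forall_2
  proof (intro conjI)
    show "has_grad (\<lambda>W. matrix_inv W $ 1 $ 1) (\<lambda>a b. - matrix_inv W $ 1 $ a * matrix_inv W $ b $ 1) W"
    proof (rule *[where c = 1 and k = 2 and l = 2])
      fix a b :: 2
      show "1 * W $ 2 $ 2 * (- inverse (det W) * matrix_inv W $ b $ a) + 1 * (if a = 2 \<and> b = 2 then 1 else 0) * inverse (det W)
        = - matrix_inv W $ 1 $ a * matrix_inv W $ b $ 1"
        using exhaust_2[of a] exhaust_2[of b] by (elim disjE; simp add: e; (use D2 in \<open>simp add: algebra_simps\<close>)?)
    qed (simp add: matrix_inv_entries)
    show "has_grad (\<lambda>W. matrix_inv W $ 1 $ 2) (\<lambda>a b. - matrix_inv W $ 1 $ a * matrix_inv W $ b $ 2) W"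
    proof (rule *[where c = "-1" and k = 1 and l = 2])
      fix a b :: 2
      show "-1 * W $ 1 $ 2 * (- inverse (det W) * matrix_inv W $ b $ a) + -1 * (if a = 1 \<and> b = 2 then 1 else 0) * inverse (det W)
        = - matrix_inv W $ 1 $ a * matrix_inv W $ b $ 2"
        using exhaust_2[of a] exhaust_2[of b] by (elim disjE; simp add: e; (use D2 in \<open>simp add: algebra_simps\<close>)?)
    qed (simp add: matrix_inv_entries)
    show "has_grad (\<lambda>W. matrix_inv W $ 2 $ 1) (\<lambda>a b. - matrix_inv W $ 2 $ a * matrix_inv W $ b $ 1) W"
    proof (rule *[where c = "-1" and k = 2 and l = 1])
      fix a b :: 2
      show "-1 * W $ 2 $ 1 * (- inverse (det W) * matrix_inv W $ b $ a) + -1 * (if a = 2 \<and> b = 1 then 1 else 0) * inverse (det W)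
        = - matrix_inv W $ 2 $ a * matrix_inv W $ b $ 1"
        using exhaust_2[of a] exhaust_2[of b] by (elim disjE; simp add: e; (use D2 in \<open>simp add: algebra_simps\<close>)?)
    qed (simp add: matrix_inv_entries)
    show "has_grad (\<lambda>W. matrix_inv W $ 2 $ 2) (\<lambda>a b. - matrix_inv W $ 2 $ a * matrix_inv W $ b $ 2) W"
    proof (rule *[where c = 1 and k = 1 and l = 1])
      fix a b :: 2
      show "1 * W $ 1 $ 1 * (- inverse (det W) * matrix_inv W $ b $ a) + 1 * (if a = 1 \<and> b = 1 then 1 else 0) * inverse (det W)
        = - matrix_inv W $ 2 $ a * matrix_inv W $ b $ 2"
        using exhaust_2[of a] exhaust_2[of b] by (elim disjE; simp add: e; (use D2 in \<open>simp add: algebra_simps\<close>)?)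
    qed (simp add: matrix_inv_entries)
  qed
  then show ?thesis by blast
qed

lemma det_matrix_inv:
  assumes "det (W::hc) \<noteq> 0"
  shows "matrix_inv W $ 1 $ 1 * matrix_inv W $ 2 $ 2 - matrix_inv W $ 1 $ 2 * matrix_inv W $ 2 $ 1 = inverse (det W)"
proof -
  define n where "n = inverse (det W)"
  have "n * (W $ 1 $ 1 * W $ 2 $ 2 - W $ 1 $ 2 * W $ 2 $ 1) = 1"
    using assms by (simp add: n_def flip: det_2)
  then have "n = n * (n * (W $ 1 $ 1 * W $ 2 $ 2 - W $ 1 $ 2 * W $ 2 $ 1))" by simp
  then show ?thesis
    unfolding matrix_inv_entries[OF assms] n_def[symmetric] by (simp add: algebra_simps)
qed

definition inv_domain :: "hc set \<Rightarrow> hc set"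
  where "inv_domain U = {W. det W \<noteq> 0 \<and> matrix_inv W \<in> U}"

lemma open_inv_domain:
  assumes "open U"
  shows "open (inv_domain U)"
proof -
  have "continuous_on {W. det W \<noteq> 0} (\<lambda>W::hc. \<chi> i j. matrix_inv W $ i $ j)"
    by (intro continuous_on_vec_lambda hol_on_continuous_on hol_onI[OF has_grad_matrix_inv]) simp
  then have "continuous_on {W. det W \<noteq> 0} (matrix_inv :: hc \<Rightarrow> hc)" by simp
  from continuous_open_preimage[OF this open_det_nonzero assms]
  show ?thesis by (simp add: inv_domain_def vimage_def Collect_conj_eq)
qed

definition kelvin :: "(hc \<Rightarrow> complex) \<Rightarrow> hc \<Rightarrow> complex"
  where "kelvin u W = inverse (det W) * u (matrix_inv W)"

text \<open>
  The gradient of a Kelvin transform is again an expression in Kelvin transforms, of \<open>u\<close> and of its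
  partial derivatives, with coefficients polynomial in the entries of the inverse. Second derivatives
  are therefore obtained by using the same rule twice.
\<close>

definition kelvin_grad :: "(hc \<Rightarrow> complex) \<Rightarrow> hc \<Rightarrow> 2 \<Rightarrow> 2 \<Rightarrow> complex"
  where "kelvin_grad u W a b = - (matrix_inv W $ b $ a * kelvin u W)
    - (\<Sum>i\<in>UNIV. \<Sum>j\<in>UNIV. matrix_inv W $ i $ a * matrix_inv W $ b $ j * kelvin (dd i j u) W)"

lemma has_grad_kelvin:
  assumes "hol_on u U" "W \<in> inv_domain U"
  shows "has_grad (kelvin u) (kelvin_grad u W) W"
proof -
  have W: "det W \<noteq> 0" "matrix_inv W \<in> U" using assms(2) by (auto simp: inv_domain_def)
  have "has_grad (\<lambda>W. u (matrix_inv W)) (\<lambda>a b. \<Sum>i\<in>UNIV. \<Sum>j\<in>UNIV.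
      (- matrix_inv W $ i $ a * matrix_inv W $ b $ j) * dd i j u (matrix_inv W)) W"
    by (rule has_grad_compose[where \<phi> = matrix_inv, OF hol_on_has_grad[OF assms(1) W(2)]])
       (rule has_grad_matrix_inv[OF W(1)])
  from has_grad_mult[OF has_grad_inverse_det[OF W(1)] this]
  show ?thesis
    unfolding kelvin_def[abs_def]
    by (rule has_grad_eq) (simp add: fun_eq_iff sum_2 kelvin_grad_def kelvin_def algebra_simps)
qed

lemma hol_on_kelvin: "hol_on u U \<Longrightarrow> hol_on (kelvin u) (inv_domain U)"
  by (rule hol_onI) (rule has_grad_kelvin)

text \<open>
  The classical property of the Kelvin transform in dimension four. All derivatives are polynomials in
  the entries of \<open>W\<^sup>-\<^sup>1\<close> times Kelvin transforms of derivatives of \<open>u\<close>, and \<open>inverse (det W)\<close> is itself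
  the determinant of \<open>W\<^sup>-\<^sup>1\<close>, so the claim is a polynomial identity.
\<close>

lemma lap_kelvin:
  assumes u: "hol_on u U" "open U" and W: "W \<in> inv_domain U"
  shows "lap (kelvin u) W = (inverse (det W))\<^sup>2 * kelvin (lap u) W"
proof -
  define p where "p = (\<lambda>i j. matrix_inv W $ i $ j)"
  have p: "p i j = matrix_inv W $ i $ j" for i j by (simp add: p_def)
  have detW: "det W \<noteq> 0" and UW: "matrix_inv W \<in> U" using W by (auto simp: inv_domain_def)
  have d2: "dd a b (dd c d (kelvin u)) W =
      - (p d c * kelvin_grad u W a b + (- p d a * p b c) * kelvin u W)
      - (\<Sum>i\<in>UNIV. \<Sum>j\<in>UNIV. (p i c * p d j) * kelvin_grad (dd i j u) W a b
          + (p i c * (- p d a * p b j) + (- p i a * p b c) * p d j) * kelvin (dd i j u) W)"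
    for a b c d
  proof -
    have "has_grad (\<lambda>W. kelvin_grad u W c d) (\<lambda>a b.
      - (p d c * kelvin_grad u W a b + (- p d a * p b c) * kelvin u W)
      - (\<Sum>i\<in>UNIV. \<Sum>j\<in>UNIV. (p i c * p d j) * kelvin_grad (dd i j u) W a b
          + (p i c * (- p d a * p b j) + (- p i a * p b c) * p d j) * kelvin (dd i j u) W)) W"
      unfolding p_def kelvin_grad_def[where a = c]
      by (intro has_grad_diff has_grad_minus has_grad_sum_2 has_grad_mult
          has_grad_matrix_inv has_grad_kelvin[of _ U] hol_on_dd u W detW)
    then have "has_grad (dd c d (kelvin u)) (\<lambda>a b.
      - (p d c * kelvin_grad u W a b + (- p d a * p b c) * kelvin u W)
      - (\<Sum>i\<in>UNIV. \<Sum>j\<in>UNIV. (p i c * p d j) * kelvin_grad (dd i j u) W a b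
          + (p i c * (- p d a * p b j) + (- p i a * p b c) * p d j) * kelvin (dd i j u) W)) W"
      by (rule has_grad_cong[OF _ open_inv_domain[OF u(2)] W _ refl])
         (simp add: has_grad_imp_dd[OF has_grad_kelvin[OF u(1)]])
    from has_grad_imp_dd[OF this] show ?thesis .
  qed
  \<comment> \<open>Symmetry of second derivatives identifies the monomials of the polynomial identity.\<close>
  have c: "kelvin (dd a b (dd c d u)) W = kelvin (dd c d (dd a b u)) W" for a b c d
    unfolding kelvin_def by (simp add: dd_commute[OF u UW])
  have l: "kelvin (lap u) W = kelvin (dd 1 1 (dd 2 2 u)) W - kelvin (dd 1 2 (dd 2 1 u)) W"
    unfolding kelvin_def lap_def by (simp add: algebra_simps)
  have n: "inverse (det W) = p 1 1 * p 2 2 - p 1 2 * p 2 1"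
    unfolding p_def by (rule det_matrix_inv[OF detW, symmetric])
  show ?thesis
    unfolding lap_def[of "kelvin u"] d2 l n
    unfolding kelvin_grad_def p[symmetric] sum_2
    unfolding c[of 2 2 1 1] c[of 2 1 1 2] c[of 1 2 1 1] c[of 2 1 1 1] c[of 2 2 1 2] c[of 2 2 2 1]
    by (simp add: algebra_simps power2_eq_square)
qed

text \<open>
  The coefficient 3 comes from the three powers of \<open>inverse (det W)\<close> in \<open>lap (kelvin u)\<close>: two are
  visible in \<open>lap_kelvin\<close> and one is contained in \<^const>\<open>kelvin\<close>.
\<close>

lemma dd_lap_kelvin:
  assumes u: "hol_on u U" "open U" and W: "W \<in> inv_domain U"
  shows "dd a b (lap (kelvin u)) W =
    - (3 * matrix_inv W $ b $ a * lap (kelvin u) W)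
    - (inverse (det W))\<^sup>2 * (\<Sum>i\<in>UNIV. \<Sum>j\<in>UNIV. matrix_inv W $ i $ a * matrix_inv W $ b $ j * kelvin (dd i j (lap u)) W)"
proof -
  define n where "n = inverse (det W)"
  have detW: "det W \<noteq> 0" using W by (auto simp: inv_domain_def)
  have "has_grad (\<lambda>W. (inverse (det W) * inverse (det W)) * kelvin (lap u) W)
     (\<lambda>a b. (n * n) * kelvin_grad (lap u) W a b + 
        (n * (- n * matrix_inv W $ b $ a) + (- n * matrix_inv W $ b $ a) * n) * kelvin (lap u) W) W"
    unfolding n_def
    by (intro has_grad_mult has_grad_inverse_det detW has_grad_kelvin[OF hol_on_lap[OF u] W])
  then have "has_grad (lap (kelvin u))
     (\<lambda>a b. (n * n) * kelvin_grad (lap u) W a b + 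
        (n * (- n * matrix_inv W $ b $ a) + (- n * matrix_inv W $ b $ a) * n) * kelvin (lap u) W) W"
    by (rule has_grad_cong[OF _ open_inv_domain[OF u(2)] W _ refl])
       (simp add: lap_kelvin[OF u] power2_eq_square)
  from has_grad_imp_dd[OF this, of a b] show ?thesis
    unfolding lap_kelvin[OF u W] kelvin_grad_def n_def[symmetric] sum_2
    by (simp add: algebra_simps power2_eq_square)
qed

lemma lap_add:
  assumes "hol_on u V" "hol_on v V" "open V" "W \<in> V"
  shows "lap (\<lambda>W. u W + v W) W = lap u W + lap v W"
proof -
  have "dd a b (dd c d (\<lambda>W. u W + v W)) W = dd a b (dd c d u) W + dd a b (dd c d v) W" for a b c d
  proof -
    have "dd a b (dd c d (\<lambda>W. u W + v W)) W = dd a b (\<lambda>W. dd c d u W + dd c d v W) W"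
      by (rule dd_cong[OF assms(3,4)])
         (rule has_grad_imp_dd[OF has_grad_add[OF hol_on_has_grad[OF assms(1)] hol_on_has_grad[OF assms(2)]]])
    also have "\<dots> = dd a b (dd c d u) W + dd a b (dd c d v) W"
      by (rule has_grad_imp_dd[OF has_grad_add[OF hol_on_has_grad[OF hol_on_dd[OF assms(1,3)] assms(4)]
          hol_on_has_grad[OF hol_on_dd[OF assms(2,3)] assms(4)]]])
    finally show ?thesis .
  qed
  then show ?thesis by (simp add: lap_def)
qed

lemma hol_on_entry_mult: "hol_on v V \<Longrightarrow> hol_on (\<lambda>W. W $ i $ j * v W) V"
  by (rule hol_onI, rule has_grad_mult[OF has_grad_entry hol_on_has_grad])

text \<open>
  The entry functions have vanishing second derivatives, so the product rule leaves one cross term, a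
  cofactor of the matrix of entry derivatives.
\<close>

lemma lap_entry_mult:
  assumes "hol_on v V" "open V" "W \<in> V"
  shows "lap (\<lambda>W. W $ i $ j * v W) W = W $ i $ j * lap v W +
    (if i = j then (if i = 1 then dd 2 2 v W else dd 1 1 v W) else - dd j i v W)"
proof -
  have "dd a b (dd c d (\<lambda>W. W $ i $ j * v W)) W =
      W $ i $ j * dd a b (dd c d v) W + (if a = i \<and> b = j then 1 else 0) * dd c d v W
       + (if c = i \<and> d = j then 1 else 0) * dd a b v W" for a b c d
  proof -
    have "dd a b (dd c d (\<lambda>W. W $ i $ j * v W)) W =
        dd a b (\<lambda>W. W $ i $ j * dd c d v W + (if c = i \<and> d = j then 1 else 0) * v W) W"
      by (rule dd_cong[OF assms(2,3)])
         (rule has_grad_imp_dd[OF has_grad_mult[OF has_grad_entry hol_on_has_grad[OF assms(1)]]])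
    also have "\<dots> = (W $ i $ j * dd a b (dd c d v) W + (if a = i \<and> b = j then 1 else 0) * dd c d v W)
       + (if c = i \<and> d = j then 1 else 0) * dd a b v W"
      by (rule has_grad_imp_dd[OF has_grad_add[OF has_grad_mult[OF has_grad_entry 
           hol_on_has_grad[OF hol_on_dd[OF assms(1,2)] assms(3)]]
            has_grad_cmult[OF hol_on_has_grad[OF assms(1,3)]]]])
    finally show ?thesis .
  qed
  then show ?thesis
    using exhaust_2[of i] exhaust_2[of j] unfolding lap_def by (auto simp: algebra_simps)
qed

text \<open>
  The commutator of \<open>\<nabla>\<box>\<close> with multiplication by \<open>W\<close>. Of the three copies of \<open>lap (v a)\<close>, two come from
  \<open>\<nabla>\<close> differentiating the factor \<open>W\<close>. The third comes from the cross terms of \<open>\<box>\<close>, which form the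
  conjugate operator applied to \<open>v\<close>: applying \<open>\<nabla>\<close> to it gives \<open>\<box>v\<close> again.
\<close>

lemma dd_lap_matrix_mult:
  assumes v: "\<And>b. hol_on (v b) V" and V: "open V" "W \<in> V"
  shows "(\<Sum>c\<in>UNIV. dd c a (lap (\<lambda>W. \<Sum>b\<in>UNIV. W $ c $ b * v b W)) W) =
    3 * lap (v a) W + (\<Sum>c\<in>UNIV. \<Sum>b\<in>UNIV. W $ c $ b * dd c a (lap (v b)) W)"
proof -
  have l: "lap (\<lambda>W. W $ i $ 1 * v 1 W + W $ i $ 2 * v 2 W) Y =
     lap (\<lambda>W. W $ i $ 1 * v 1 W) Y + lap (\<lambda>W. W $ i $ 2 * v 2 W) Y" if "Y \<in> V" for i Y
    by (rule lap_add[OF hol_on_entry_mult[OF v] hol_on_entry_mult[OF v] V(1) that])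
  have h: "has_grad (lap (v b)) (\<lambda>c d. dd c d (lap (v b)) W) W" 
     "has_grad (dd i j (v b)) (\<lambda>c d. dd c d (dd i j (v b)) W) W" for b i j
    by (rule hol_on_has_grad[OF hol_on_lap[OF v V(1)] V(2)]) 
       (rule hol_on_has_grad[OF hol_on_dd[OF v V(1)] V(2)])
  have 1: "dd c d (lap (\<lambda>W. W $ 1 $ 1 * v 1 W + W $ 1 $ 2 * v 2 W)) W =
     (W $ 1 $ 1 * dd c d (lap (v 1)) W + (if c = 1 \<and> d = 1 then 1 else 0) * lap (v 1) W + dd c d (dd 2 2 (v 1)) W)
     + (W $ 1 $ 2 * dd c d (lap (v 2)) W + (if c = 1 \<and> d = 2 then 1 else 0) * lap (v 2) W + - dd c d (dd 2 1 (v 2)) W)"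
    for c d
  proof -
    have "dd c d (lap (\<lambda>W. W $ 1 $ 1 * v 1 W + W $ 1 $ 2 * v 2 W)) W =
      dd c d (\<lambda>W. (W $ 1 $ 1 * lap (v 1) W + dd 2 2 (v 1) W) + (W $ 1 $ 2 * lap (v 2) W + - dd 2 1 (v 2) W)) W"
      by (rule dd_cong[OF V]) (simp add: l lap_entry_mult[OF v V(1)])
    also have "has_grad (\<lambda>W. (W $ 1 $ 1 * lap (v 1) W + dd 2 2 (v 1) W) + (W $ 1 $ 2 * lap (v 2) W + - dd 2 1 (v 2) W))
     (\<lambda>c d. (W $ 1 $ 1 * dd c d (lap (v 1)) W + (if c = 1 \<and> d = 1 then 1 else 0) * lap (v 1) W + dd c d (dd 2 2 (v 1)) W)
     + (W $ 1 $ 2 * dd c d (lap (v 2)) W + (if c = 1 \<and> d = 2 then 1 else 0) * lap (v 2) W + - dd c d (dd 2 1 (v 2)) W)) W"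
      by (intro has_grad_add has_grad_minus has_grad_mult has_grad_entry h)
    note has_grad_imp_dd[OF this]
    finally show ?thesis .
  qed
  have 2: "dd c d (lap (\<lambda>W. W $ 2 $ 1 * v 1 W + W $ 2 $ 2 * v 2 W)) W =
     (W $ 2 $ 1 * dd c d (lap (v 1)) W + (if c = 2 \<and> d = 1 then 1 else 0) * lap (v 1) W + - dd c d (dd 1 2 (v 1)) W)
     + (W $ 2 $ 2 * dd c d (lap (v 2)) W + (if c = 2 \<and> d = 2 then 1 else 0) * lap (v 2) W + dd c d (dd 1 1 (v 2)) W)"
    for c d
  proof -
    have "dd c d (lap (\<lambda>W. W $ 2 $ 1 * v 1 W + W $ 2 $ 2 * v 2 W)) W =
      dd c d (\<lambda>W. (W $ 2 $ 1 * lap (v 1) W + - dd 1 2 (v 1) W) + (W $ 2 $ 2 * lap (v 2) W + dd 1 1 (v 2) W)) W"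
      by (rule dd_cong[OF V]) (simp add: l lap_entry_mult[OF v V(1)])
    also have "has_grad (\<lambda>W. (W $ 2 $ 1 * lap (v 1) W + - dd 1 2 (v 1) W) + (W $ 2 $ 2 * lap (v 2) W + dd 1 1 (v 2) W))
     (\<lambda>c d. (W $ 2 $ 1 * dd c d (lap (v 1)) W + (if c = 2 \<and> d = 1 then 1 else 0) * lap (v 1) W + - dd c d (dd 1 2 (v 1)) W)
     + (W $ 2 $ 2 * dd c d (lap (v 2)) W + (if c = 2 \<and> d = 2 then 1 else 0) * lap (v 2) W + dd c d (dd 1 1 (v 2)) W)) W"
      by (intro has_grad_add has_grad_minus has_grad_mult has_grad_entry h)
    note has_grad_imp_dd[OF this]
    finally show ?thesis .
  qed
  have c: "dd 2 2 (dd 1 1 (v b)) W = dd 1 1 (dd 2 2 (v b)) W" "dd 2 1 (dd 1 2 (v b)) W = dd 1 2 (dd 2 1 (v b)) W"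
     "dd 2 1 (dd 1 1 (v b)) W = dd 1 1 (dd 2 1 (v b)) W"  "dd 2 2 (dd 1 2 (v b)) W = dd 1 2 (dd 2 2 (v b)) W" for b
    by (rule dd_commute[OF v V])+
  show ?thesis
    using exhaust_2[of a] unfolding sum_2 1 2
    by (elim disjE; simp add: c; simp add: lap_def algebra_simps)
qed

text \<open>
  The commutator term \<open>3 lap v\<close> cancels against the derivative of \<open>N\<^sup>-\<^sup>3\<close>. In the remaining sum the
  matrix \<open>W\<close> meets its inverse, and the regularity of \<open>f\<close> at \<open>W\<^sup>-\<^sup>1\<close> appears.
\<close>

lemma quasi_left_anti_regular_inversion:
  assumes "quasi_left_anti_regular_on U f"
  shows "quasi_left_anti_regular_on (inv_domain U) (\<lambda>W. ((1 / det W) *C W) *v f (matrix_inv W))"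
proof -
  define v where "v = (\<lambda>b. kelvin (\<lambda>Z. f Z $ b))"
  have U: "open U" and h: "\<And>i. hol_on (\<lambda>Z. f Z $ i) U"
    and r: "\<And>Z a. Z \<in> U \<Longrightarrow> (\<Sum>b\<in>UNIV. dd b a (lap (\<lambda>Z. f Z $ b)) Z) = 0"
    using assms unfolding quasi_left_anti_regular_on_iff by auto
  have V: "open (inv_domain U)" by (rule open_inv_domain[OF U])
  have hv: "hol_on (v b) (inv_domain U)" for b unfolding v_def by (rule hol_on_kelvin[OF h])
  have comp: "(((1 / det W) *C W) *v f (matrix_inv W)) $ i = (\<Sum>b\<in>UNIV. W $ i $ b * v b W)" for W i
    by (simp add: matrix_vector_mult_def sum_2 v_def kelvin_def field_simps)
  show ?thesis
    unfolding quasi_left_anti_regular_on_iff comp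
  proof (intro conjI allI ballI V)
    show "hol_on (\<lambda>W. \<Sum>b\<in>UNIV. W $ i $ b * v b W) (inv_domain U)" for i
      by (rule hol_onI, rule has_grad_sum_2, rule has_grad_mult[OF has_grad_entry hol_on_has_grad[OF hv]])
    fix W a assume W: "W \<in> inv_domain U"
    then have detW: "det W \<noteq> 0" and UW: "matrix_inv W \<in> U" by (auto simp: inv_domain_def)
    define p where "p = (\<lambda>i j. matrix_inv W $ i $ j)"
    define L where "L = (\<lambda>i j b. kelvin (dd i j (lap (\<lambda>Z. f Z $ b))) W)"
    have inv1: "(\<Sum>c\<in>UNIV. p i c * W $ c $ b) = (if i = b then 1 else 0)" for i b
      using matrix_inv_mult(2)[OF detW] unfolding p_def vec_eq_iff matrix_matrix_mult_def mat_def by simp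
    have reg: "(\<Sum>b\<in>UNIV. L b j b) = 0" for j
      using r[OF UW, of j] unfolding L_def kelvin_def by (simp flip: sum_distrib_left)
    have "(\<Sum>c\<in>UNIV. \<Sum>b\<in>UNIV. W $ c $ b * dd c a (lap (v b)) W) =
      - 3 * (\<Sum>b\<in>UNIV. (\<Sum>c\<in>UNIV. p a c * W $ c $ b) * lap (v b) W)
      - (inverse (det W))\<^sup>2 * (\<Sum>j\<in>UNIV. p a j * (\<Sum>b\<in>UNIV. \<Sum>i\<in>UNIV. (\<Sum>c\<in>UNIV. p i c * W $ c $ b) * L i j b))"
      unfolding v_def dd_lap_kelvin[OF h U W] p_def L_def sum_2 by (simp add: algebra_simps)
    also have "\<dots> = - 3 * lap (v a) W - (inverse (det W))\<^sup>2 * (\<Sum>j\<in>UNIV. p a j * (\<Sum>b\<in>UNIV. L b j b))"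
      unfolding inv1 using exhaust_2[of a] by (auto simp: sum_2)
    finally have "(\<Sum>c\<in>UNIV. \<Sum>b\<in>UNIV. W $ c $ b * dd c a (lap (v b)) W) = - 3 * lap (v a) W"
      by (simp add: reg)
    then show "(\<Sum>c\<in>UNIV. dd c a (lap (\<lambda>W. \<Sum>b\<in>UNIV. W $ c $ b * v b W)) W) = 0"
      unfolding dd_lap_matrix_mult[OF hv V W] by simp
  qed
qed

section \<open>Fractional linear transformations as compositions\<close>

lemma matrix_mult_uminus_right: "(A::hc) ** (- B) = - (A ** B)"
  by (simp add: vec_eq_iff matrix_matrix_mult_def sum_2)

lemma matrix_mult_diff_left: "(A - B :: hc) ** C = A ** C - B ** C"
  by (simp add: vec_eq_iff matrix_matrix_mult_def sum_2 algebra_simps)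

lemma matrix_inv_unique_left:
  assumes "det (A::hc) \<noteq> 0" "A ** X = Y"
  shows "X = matrix_inv A ** Y"
proof -
  have "matrix_inv A ** Y = (matrix_inv A ** A) ** X" by (simp add: assms(2) flip: matrix_mul_assoc)
  then show ?thesis by (simp add: matrix_inv_mult(2)[OF assms(1)])
qed

text \<open>
  With \<open>X\<close> and \<open>S - Z\<close> invertible, the fractional linear map is \<open>Q - X\<^sup>-\<^sup>1 (c Q + d)\<close>: the inversion of an
  affine function of \<open>(S - Z)\<^sup>-\<^sup>1\<close>, followed by an affine map. The first equation is the cocycle
  property that makes the prefactors match.
\<close>

lemma linear_fractional_factorisation:
  fixes a b c d S Z :: hc
  defines "P \<equiv> a - S ** c"
  defines "Q \<equiv> matrix_inv P ** (S ** d - b)"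
  defines "X \<equiv> c + matrix_inv (S - Z) ** P"
  assumes P: "det P \<noteq> 0" and SZ: "det (S - Z) \<noteq> 0"
  shows "a - Z ** c = (S - Z) ** X"
    and "det (a - Z ** c) \<noteq> 0 \<Longrightarrow>
      Q + matrix_inv X ** (- (c ** Q + d)) = matrix_inv (a - Z ** c) ** (- b + Z ** d)"
proof -
  have "(S - Z) ** X = (S - Z) ** c + ((S - Z) ** matrix_inv (S - Z)) ** P"
    unfolding X_def by (simp add: matrix_add_ldistrib matrix_mul_assoc)
  also have "\<dots> = a - Z ** c"
    unfolding matrix_inv_mult(1)[OF SZ] P_def by (simp add: matrix_mul_lid matrix_mult_diff_left)
  finally show A: "a - Z ** c = (S - Z) ** X" by simp
  assume dA: "det (a - Z ** c) \<noteq> 0"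
  then have dX: "det X \<noteq> 0" unfolding A det_mul by simp
  have PQ: "P ** Q = S ** d - b"
    unfolding Q_def matrix_mul_assoc matrix_inv_mult(1)[OF P] by simp
  have "(a - Z ** c) ** (Q + matrix_inv X ** (- (c ** Q + d)))
      = (a - Z ** c) ** Q - (S - Z) ** (X ** matrix_inv X) ** (c ** Q + d)"
    unfolding matrix_add_ldistrib matrix_mult_uminus_right by (simp add: A matrix_mul_assoc)
  also have "\<dots> = (a - Z ** c) ** Q - (S - Z) ** (c ** Q + d)"
    unfolding matrix_inv_mult(1)[OF dX] by simp
  also have "\<dots> = P ** Q - (S - Z) ** d"
    unfolding P_def by (simp add: matrix_add_ldistrib matrix_mult_diff_left matrix_mul_assoc)
  also have "\<dots> = - b + Z ** d"
    unfolding PQ by (simp add: matrix_mult_diff_left)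
  finally show "Q + matrix_inv X ** (- (c ** Q + d)) = matrix_inv (a - Z ** c) ** (- b + Z ** d)"
    by (rule matrix_inv_unique_left[OF dA])
qed

text \<open>
  The matrices \<open>S = Z + t\<close> with \<open>t\<close> a small nonzero scalar will do.
\<close>

lemma exists_base_point:
  assumes "det (a - Z ** c) \<noteq> (0::complex)"
  shows "\<exists>S::hc. det (S - Z) \<noteq> 0 \<and> det (a - S ** c) \<noteq> 0"
proof -
  have c: "isCont (\<lambda>t. det (a - (Z + mat t) ** c)) 0"
    unfolding det_2 matrix_matrix_mult_def mat_def sum_2
    by simp
  have "mat 0 = (0::hc)" by (simp add: mat_def vec_eq_iff)
  then have "\<forall>\<^sub>F t in at 0. det (a - (Z + mat t) ** c) \<noteq> 0"
    using c assms by (intro tendsto_imp_eventually_ne[of _ "det (a - Z ** c)"]) (auto simp: isCont_def)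
  moreover have "\<forall>\<^sub>F t in at (0::complex). t \<noteq> 0" by (simp add: eventually_at_filter)
  ultimately have "\<forall>\<^sub>F t in at (0::complex). t \<noteq> 0 \<and> det (a - (Z + mat t) ** c) \<noteq> 0"
    by (rule eventually_conj[rotated])
  then obtain t where "t \<noteq> 0" "det (a - (Z + mat t) ** c) \<noteq> 0"
    using eventually_happens[of _ "at (0::complex)"] by force
  then show ?thesis by (intro exI[of _ "Z + mat t"]) (auto simp: det_2 mat_def)
qed

text \<open>
  Near a point of the domain a base point \<open>S\<close> is chosen, and the action is rebuilt from \<open>f\<close> by affine
  substitutions and inversions.
\<close>

lemma quasi_left_anti_regular_pi_l:
  assumes "quasi_left_anti_regular_on U f"
  shows "quasi_left_anti_regular_on (pi_l_domain h U) (pi_l h f)"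
proof (rule quasi_left_anti_regular_on_localI)
  fix Z0 assume Z0: "Z0 \<in> pi_l_domain h U"
  define a b c d where "a = h $ 1 $ 1" "b = h $ 1 $ 2" "c = h $ 2 $ 1" "d = h $ 2 $ 2"
  note abcd = this
  have dom: "Z \<in> pi_l_domain h U \<longleftrightarrow> det (a - Z ** c) \<noteq> 0 \<and> matrix_inv (a - Z ** c) ** (- b + Z ** d) \<in> U" for Z
    by (simp add: pi_l_domain_def Let_def abcd invertible_det_nz)
  have pil: "pi_l h f Z = ((1 / det (a - Z ** c)) *C (a - Z ** c)) *v f (matrix_inv (a - Z ** c) ** (- b + Z ** d))" for Z
    by (simp add: pi_l_def Let_def abcd)
  obtain S where S: "det (S - Z0) \<noteq> 0" "det (a - S ** c) \<noteq> 0"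
    using exists_base_point[of a Z0 c] Z0 dom by blast
  define P where "P = a - S ** c"
  define Q where "Q = matrix_inv P ** (S ** d - b)"
  define E where "E = c ** Q + d"
  \<comment> \<open>Starting from \<open>f\<close>, each function is the preceding one transformed by one of the five maps.\<close>
  define U1 where "U1 = {Y. Q + Y ** (- E) \<in> U}"
  define U3 where "U3 = {W. c + W ** P \<in> inv_domain U1}"
  define U5 where "U5 = {Z. S + Z ** (- mat 1) \<in> inv_domain U3}"
  define f1 where "f1 = (\<lambda>Y. f (Q + Y ** (- E)))"
  define f2 where "f2 = (\<lambda>W. ((1 / det W) *C W) *v f1 (matrix_inv W))"
  define f3 where "f3 = (\<lambda>W. f2 (c + W ** P))"
  define f4 where "f4 = (\<lambda>W. ((1 / det W) *C W) *v f3 (matrix_inv W))"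
  define f5 where "f5 = (\<lambda>Z. f4 (S + Z ** (- mat 1)))"
  have "quasi_left_anti_regular_on U1 f1"
    unfolding U1_def f1_def by (rule quasi_left_anti_regular_affine[OF assms])
  then have "quasi_left_anti_regular_on (inv_domain U1) f2"
    unfolding f2_def by (rule quasi_left_anti_regular_inversion)
  then have "quasi_left_anti_regular_on U3 f3"
    unfolding U3_def f3_def by (rule quasi_left_anti_regular_affine)
  then have "quasi_left_anti_regular_on (inv_domain U3) f4"
    unfolding f4_def by (rule quasi_left_anti_regular_inversion)
  then have reg: "quasi_left_anti_regular_on U5 f5"
    unfolding U5_def f5_def by (rule quasi_left_anti_regular_affine)
  have P: "det P \<noteq> 0" using S(2) by (simp add: P_def)
  have SZ: "S + Z ** (- mat 1) = S - Z" for Z by (simp add: matrix_mult_uminus_right)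
  note fac = linear_fractional_factorisation(1)[of a S c, folded P_def, OF P]
    linear_fractional_factorisation(2)[where a = a and b = b and c = c and d = d and S = S,
      folded P_def, folded Q_def, folded E_def, OF P]
  \<comment> \<open>The composition of the five factors is defined wherever the original is, as long as \<open>S - Z\<close> is invertible.\<close>
  have U5: "Z \<in> U5 \<longleftrightarrow> det (S - Z) \<noteq> 0 \<and> Z \<in> pi_l_domain h U" for Z
  proof (cases "det (S - Z) = 0")
    case False
    have "det (c + matrix_inv (S - Z) ** P) \<noteq> 0 \<longleftrightarrow> det (a - Z ** c) \<noteq> 0"
      unfolding fac(1)[OF False] det_mul using False by simp
    then show ?thesis
      using fac(2)[OF False] False unfolding U5_def U3_def U1_def inv_domain_def SZ dom by auto
  qed (simp add: U5_def inv_domain_def SZ)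
  have eq: "pi_l h f Z = f5 Z" if "Z \<in> U5" for Z
  proof -
    have nz: "det (S - Z) \<noteq> 0" and A: "det (a - Z ** c) \<noteq> 0" using that by (auto simp: U5 dom)
    define X where "X = c + matrix_inv (S - Z) ** P"
    have AX: "a - Z ** c = (S - Z) ** X" unfolding X_def by (rule fac(1)[OF nz])
    have "f5 Z = ((1 / det (S - Z)) *C (S - Z)) *v (((1 / det X) *C X) *v f (Q + matrix_inv X ** (- E)))"
      unfolding f5_def f4_def f3_def f2_def f1_def SZ X_def ..
    also have "Q + matrix_inv X ** (- E) = matrix_inv (a - Z ** c) ** (- b + Z ** d)"
      unfolding X_def by (rule fac(2)[OF nz A])
    also have "((1 / det (S - Z)) *C (S - Z)) *v (((1 / det X) *C X) *v s) 
       = ((1 / det (a - Z ** c)) *C (a - Z ** c)) *v s" for s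
    proof -
      have "((1 / det (S - Z)) *C (S - Z)) ** ((1 / det X) *C X) = (1 / det ((S - Z) ** X)) *C ((S - Z) ** X)"
        unfolding det_mul by (simp add: vec_eq_iff matrix_matrix_mult_def sum_2 add_divide_distrib)
      then show ?thesis by (simp add: AX matrix_vector_mul_assoc)
    qed
    finally show ?thesis by (simp add: pil)
  qed
  show "\<exists>W G. Z0 \<in> W \<and> W \<subseteq> pi_l_domain h U \<and> quasi_left_anti_regular_on W G \<and> (\<forall>Y\<in>W. pi_l h f Y = G Y)"
  proof (intro exI conjI ballI)
    show "Z0 \<in> U5" using Z0 S(1) by (simp add: U5)
    show "U5 \<subseteq> pi_l_domain h U" by (auto simp: U5)
  qed (rule reg, rule eq)
qed

section \<open>Transposition and the right action\<close>

lemma dd_transpose: "dd a b (\<lambda>Z. u (transpose Z)) Z = dd b a u (transpose Z)"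
proof -
  have "transpose (Z + t *C unit_mat a b) = transpose Z + t *C unit_mat b a" for t
    by (simp add: vec_eq_iff transpose_def)
  then show ?thesis unfolding dd_def by simp
qed

lemma has_grad_transpose:
  assumes "has_grad u g (transpose Z)"
  shows "has_grad (\<lambda>Z. u (transpose Z)) (\<lambda>a b. g b a) Z"
proof -
  have "has_grad (\<lambda>Z. u (transpose Z)) 
     (\<lambda>a b. \<Sum>i\<in>UNIV. \<Sum>j\<in>UNIV. (if a = j \<and> b = i then 1 else 0) * g i j) Z"
    by (rule has_grad_compose[where \<phi> = transpose, OF assms])
       (simp add: transpose_def has_grad_entry)
  then show ?thesis
  proof (rule has_grad_eq, intro ext)
    fix a b
    show "(\<Sum>i\<in>UNIV. \<Sum>j\<in>UNIV. (if a = j \<and> b = i then 1 else 0) * g i j) = g b a"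
      using exhaust_2[of a] exhaust_2[of b] by (auto simp: sum_2)
  qed
qed

lemma open_transpose_vimage: "open U \<Longrightarrow> open {Z::hc. transpose Z \<in> U}"
  unfolding transpose_def by (rule open_vimage[unfolded vimage_def], assumption) (intro continuous_intros)

lemma hol_on_transpose: "hol_on u U \<Longrightarrow> hol_on (\<lambda>Z. u (transpose Z)) {Z. transpose Z \<in> U}"
  by (rule hol_onI, rule has_grad_transpose, rule hol_on_has_grad) auto

lemma dd_lap_transpose:
  assumes "hol_on u U" "open U" "transpose Z \<in> U"
  shows "dd a b (lap (\<lambda>Z. u (transpose Z))) Z = dd b a (lap u) (transpose Z)"
proof -
  have "lap (\<lambda>Z. u (transpose Z)) Y = lap u (transpose Y)" if "transpose Y \<in> U" for Y
    using dd_commute[OF assms(1,2) that, of 2 1 1 2]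
    by (simp add: lap_def dd_transpose[abs_def])
  then have "dd a b (lap (\<lambda>Z. u (transpose Z))) Z = dd a b (\<lambda>Z. lap u (transpose Z)) Z"
    by (intro dd_cong[OF open_transpose_vimage[OF assms(2)]]) (use assms(3) in auto)
  then show ?thesis by (simp add: dd_transpose)
qed

lemma quasi_right_anti_regular_on_cong:
  assumes "quasi_right_anti_regular_on U F" "\<And>Z. Z \<in> U \<Longrightarrow> F Z = G Z"
  shows "quasi_right_anti_regular_on U G"
proof -
  have U: "open U" and h: "\<And>i. hol_on (\<lambda>Z. F Z $ i) U"
    and r: "\<And>Z a. Z \<in> U \<Longrightarrow> (\<Sum>b\<in>UNIV. dd a b (lap (\<lambda>Z. F Z $ b)) Z) = 0"
    using assms(1) unfolding quasi_right_anti_regular_on_iff by auto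
  have eq: "F Z $ i = G Z $ i" if "Z \<in> U" for Z i by (simp only: assms(2)[OF that])
  have dl: "dd a b (lap (\<lambda>Z. F Z $ b)) Z = dd a b (lap (\<lambda>Z. G Z $ b)) Z" if "Z \<in> U" for Z a b
    by (rule dd_cong[OF U that], rule lap_cong[OF U _ eq])
  show ?thesis
    unfolding quasi_right_anti_regular_on_iff
    using U hol_on_cong[OF h U eq] r by (simp add: dl)
qed

text \<open>
  Transposing the argument exchanges the two indices of an entry derivative and keeps \<open>lap\<close>, hence it
  exchanges the left and the right equations.
\<close>

lemma quasi_right_imp_left_transpose:
  assumes "quasi_right_anti_regular_on U g"
  shows "quasi_left_anti_regular_on {Z. transpose Z \<in> U} (\<lambda>Z. g (transpose Z))"
proof -
  have U: "open U" and h: "\<And>i. hol_on (\<lambda>Z. g Z $ i) U"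
    and r: "\<And>Z a. Z \<in> U \<Longrightarrow> (\<Sum>b\<in>UNIV. dd a b (lap (\<lambda>Z. g Z $ b)) Z) = 0"
    using assms unfolding quasi_right_anti_regular_on_iff by auto
  show ?thesis
    unfolding quasi_left_anti_regular_on_iff
    using open_transpose_vimage[OF U] hol_on_transpose[OF h] by (simp add: dd_lap_transpose[OF h U] r)
qed

lemma quasi_left_imp_right_transpose:
  assumes "quasi_left_anti_regular_on U g"
  shows "quasi_right_anti_regular_on {Z. transpose Z \<in> U} (\<lambda>Z. g (transpose Z))"
proof -
  have U: "open U" and h: "\<And>i. hol_on (\<lambda>Z. g Z $ i) U"
    and r: "\<And>Z a. Z \<in> U \<Longrightarrow> (\<Sum>b\<in>UNIV. dd b a (lap (\<lambda>Z. g Z $ b)) Z) = 0"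
    using assms unfolding quasi_left_anti_regular_on_iff by auto
  show ?thesis
    unfolding quasi_right_anti_regular_on_iff
    using open_transpose_vimage[OF U] hol_on_transpose[OF h] by (simp add: dd_lap_transpose[OF h U] r)
qed

lemma matrix_inv_transpose:
  assumes "det (A::hc) \<noteq> 0"
  shows "matrix_inv (transpose A) = transpose (matrix_inv A)"
proof -
  have "transpose A ** transpose (matrix_inv A) = mat 1"
    by (simp add: matrix_inv_mult(2)[OF assms] transpose_mat flip: matrix_transpose_mul)
  from matrix_inv_unique_left[OF _ this] show ?thesis using assms by (simp add: det_transpose)
qed

text \<open>
  Transposing \<open>(a Z + b) (c Z + d)\<^sup>-\<^sup>1\<close> gives the expression of the left action for the block matrix
  \<open>k\<close> with entries \<open>d\<^sup>T, - b\<^sup>T, - c\<^sup>T, a\<^sup>T\<close>.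
\<close>

lemma quasi_right_anti_regular_pi_r:
  assumes "quasi_right_anti_regular_on U g"
  shows "quasi_right_anti_regular_on (pi_r_domain h U) (pi_r h g)"
proof -
  define a b c d where "a = GL2_HC_inv h $ 1 $ 1" "b = GL2_HC_inv h $ 1 $ 2"
    "c = GL2_HC_inv h $ 2 $ 1" "d = GL2_HC_inv h $ 2 $ 2"
  note abcd = this
  define k :: hc_mat where "k = vector [vector [transpose d, - transpose b], vector [- transpose c, transpose a]]"
  define U' where "U' = {Z. transpose Z \<in> U}"
  define g' where "g' = (\<lambda>Z. g (transpose Z))"
  have A: "transpose d - transpose Z ** (- transpose c) = transpose (c ** Z + d)" for Z
    by (simp add: vec_eq_iff transpose_def matrix_matrix_mult_def sum_2 algebra_simps)
  have B: "- (- transpose b) + transpose Z ** transpose a = transpose (a ** Z + b)" for Z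
    by (simp add: vec_eq_iff transpose_def matrix_matrix_mult_def sum_2 algebra_simps)
  have arg: "transpose (matrix_inv (transpose (c ** Z + d)) ** transpose (a ** Z + b)) = (a ** Z + b) ** matrix_inv (c ** Z + d)"
    if "det (c ** Z + d) \<noteq> 0" for Z
    by (simp add: matrix_inv_transpose[OF that] matrix_transpose_mul)
  have k: "k $ 1 $ 1 = transpose d" "k $ 1 $ 2 = - transpose b" "k $ 2 $ 1 = - transpose c" "k $ 2 $ 2 = transpose a"
    by (simp_all add: k_def)
  have dom: "transpose Z \<in> pi_l_domain k U' \<longleftrightarrow> Z \<in> pi_r_domain h U" for Z
    unfolding pi_l_domain_def pi_r_domain_def Let_def k abcd[symmetric] U'_def
    unfolding mem_Collect_eq A B
    using arg[of Z] by (auto simp: invertible_det_nz det_transpose)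
  have eq: "pi_l k g' (transpose Z) = pi_r h g Z" if "Z \<in> pi_r_domain h U" for Z
  proof -
    have nz: "det (c ** Z + d) \<noteq> 0"
      using that unfolding pi_r_domain_def Let_def abcd[symmetric] invertible_det_nz by simp
    have "r *C transpose M = transpose (r *C M)" for r M by (simp add: vec_eq_iff transpose_def)
    then show ?thesis
      unfolding pi_l_def pi_r_def Let_def k abcd[symmetric] g'_def
      unfolding A B arg[OF nz]
      by (simp add: det_transpose)
  qed
  have "quasi_left_anti_regular_on (pi_l_domain k U') (pi_l k g')"
    unfolding U'_def g'_def
    by (rule quasi_left_anti_regular_pi_l[OF quasi_right_imp_left_transpose[OF assms]])
  from quasi_left_imp_right_transpose[OF this]
  have r: "quasi_right_anti_regular_on (pi_r_domain h U) (\<lambda>Z. pi_l k g' (transpose Z))"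
    by (simp add: dom)
  show ?thesis
    by (rule quasi_right_anti_regular_on_cong[OF r eq])
qed

theorem theorem16:
  shows "(\<forall>h\<in>GL2_HC. \<forall>U f. quasi_left_anti_regular_on U f \<longrightarrow>
            quasi_left_anti_regular_on (pi_l_domain h U) (pi_l h f)) \<and>
         (\<forall>h\<in>GL2_HC. \<forall>U g. quasi_right_anti_regular_on U g \<longrightarrow>
            quasi_right_anti_regular_on (pi_r_domain h U) (pi_r h g))"
  using quasi_left_anti_regular_pi_l quasi_right_anti_regular_pi_r by blast

end
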